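(* Let $n\ge 1$ and let $F:\mathbb{R}^n\to\mathbb{R}^n$ be a dominant rational map (not necessarily defined everywhere). If the geometric degree of $F$ is $1$, then the field extension $\mathbb{R}(X)/\mathbb{R}(F)$ has odd degree and has trivial automorphism group (i.e. the only field automorphism of $\mathbb{R}(X)$ fixing every element of $\mathbb{R}(F)$ is the identity).
   Context: A rational map $F=(F_1,\dots,F_n):\mathbb{R}^n\to\mathbb{R}^n$ is given by $n$ rational functions $F_i\in\mathbb{R}(X)=\mathbb{R}(x_1,\dots,x_n)$; it need not be defined at every point. Its Jacobian determinant is denoted $j(F)$, and $F$ is dominant if and only if $j(F)$ is not identically zero. In that case $F_1,\dots,F_n$ are algebraically independent over $\mathbb{R}$; $\mathbb{R}(F)=\mathbb{R}(F_1,\dots,F_n)\subseteq\mathbb{R}(X)$ denotes the subfield they generate over $\mathbb{R}$, and $\mathbb{R}(X)/\mathbb{R}(F)$ is a finite algebraic extension. If $F$ is generically $N$-to-one for a positive integer $N$, that is, for all $y$ in some nonempty Zariski open subset of the codomain $\mathbb{R}^n$ there are exactly $N$ points $x$ in the domain of definition of $F$ with $F(x)=y$, then $N$ is called the geometric degree of $F$ (a dominant rational map need not have a geometric degree). *)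

theory Defs
  imports
    "HOL-Analysis.Finite_Cartesian_Product"
    "HOL-Library.Poly_Mapping"
    "HOL-Computational_Algebra.Fraction_Field"
    "HOL-Algebra.Generated_Fields"
    "HOL-Algebra.Embedded_Algebras"
    "HOL-Algebra.Algebraic_Closure_Type"
begin

text \<open>
  Polynomials over the reals in variables indexed by a finite type, as finitely supported
  functions from exponent vectors to coefficients. A linear order on the index type is assumed
  only because the library's proof that these polynomials form an integral domain uses it.
\<close>

type_synonym 'n rpoly = "('n \<Rightarrow>\<^sub>0 nat) \<Rightarrow>\<^sub>0 real"

type_synonym 'n ratfun = "'n rpoly fract"

type_synonym 'n point = "(real, 'n) vec"

type_synonym 'n ratmap = "('n ratfun, 'n) vec"

definition poly_eval :: "'n::{finite,linorder} rpoly \<Rightarrow> 'n point \<Rightarrow> real" where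
  "poly_eval p x = (\<Sum>m\<in>Poly_Mapping.keys p.
     Poly_Mapping.lookup p m * (\<Prod>i\<in>UNIV. (x $ i) ^ Poly_Mapping.lookup m i))"

lemma poly_eval_superset:
  assumes "finite A" "Poly_Mapping.keys p \<subseteq> A"
  shows "poly_eval p x = (\<Sum>m\<in>A.
     Poly_Mapping.lookup p m * (\<Prod>i\<in>UNIV. (x $ i) ^ Poly_Mapping.lookup m i))"
  unfolding poly_eval_def
  by (rule sum.mono_neutral_left) (use assms in \<open>auto simp: in_keys_iff\<close>)

lemma poly_eval_0 [simp]: "poly_eval 0 x = 0"
  by (simp add: poly_eval_def)

lemma poly_eval_add: "poly_eval (p + q) x = poly_eval p x + poly_eval q x"
proof -
  let ?A = "Poly_Mapping.keys p \<union> Poly_Mapping.keys q"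
  have "Poly_Mapping.keys (p + q) \<subseteq> ?A"
    by (rule Poly_Mapping.keys_add)
  then show ?thesis
    by (simp add: poly_eval_superset[of ?A] lookup_add algebra_simps sum.distrib)
qed

lemma poly_eval_sum: "poly_eval (\<Sum>a\<in>A. f a) x = (\<Sum>a\<in>A. poly_eval (f a) x)"
  by (induction A rule: infinite_finite_induct) (auto simp: poly_eval_add)

lemma poly_eval_single:
  "poly_eval (Poly_Mapping.single m c) x = c * (\<Prod>i\<in>UNIV. (x $ i) ^ Poly_Mapping.lookup m i)"
  by (simp add: poly_eval_superset[of "{m}"])

lemma rpoly_sum_single:
  "(p :: 'n::{finite,linorder} rpoly) = (\<Sum>m\<in>Poly_Mapping.keys p. Poly_Mapping.single m (Poly_Mapping.lookup p m))"
  by (rule poly_mapping_eqI)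
    (auto simp: lookup_sum lookup_single when_def in_keys_iff)

lemma poly_eval_mult: "poly_eval (p * q) x = poly_eval p x * poly_eval q x"
proof -
  let ?s = "\<lambda>p m. Poly_Mapping.single m (Poly_Mapping.lookup p m)"
  have "p * q = (\<Sum>m\<in>Poly_Mapping.keys p. ?s p m) * (\<Sum>m\<in>Poly_Mapping.keys q. ?s q m)"
    by (subst (1 2) rpoly_sum_single) (rule refl)
  also have "\<dots> = (\<Sum>m\<in>Poly_Mapping.keys p. \<Sum>l\<in>Poly_Mapping.keys q. ?s p m * ?s q l)"
    by (rule sum_product)
  finally have "poly_eval (p * q) x = (\<Sum>m\<in>Poly_Mapping.keys p. \<Sum>l\<in>Poly_Mapping.keys q.
      poly_eval (?s p m * ?s q l) x)"
    by (simp add: poly_eval_sum)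
  also have "\<dots> = (\<Sum>m\<in>Poly_Mapping.keys p. \<Sum>l\<in>Poly_Mapping.keys q.
      poly_eval (?s p m) x * poly_eval (?s q l) x)"
    by (simp add: mult_single poly_eval_single lookup_add power_add prod.distrib algebra_simps)
  also have "\<dots> = poly_eval p x * poly_eval q x"
    by (simp add: poly_eval_single flip: sum_product) (simp add: poly_eval_def)
  finally show ?thesis .
qed

text \<open>
  A rational function is defined at a point if it has some representation whose denominator does
  not vanish there, so cancellation of common factors is taken into account.
\<close>

definition ratfun_defined :: "'n::{finite,linorder} ratfun \<Rightarrow> 'n point \<Rightarrow> bool" where
  "ratfun_defined r x \<longleftrightarrow> (\<exists>p q. r = Fract p q \<and> poly_eval q x \<noteq> 0)"

definition ratfun_eval :: "'n::{finite,linorder} ratfun \<Rightarrow> 'n point \<Rightarrow> real" where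
  "ratfun_eval r x =
     (THE v. \<exists>p q. r = Fract p q \<and> poly_eval q x \<noteq> 0 \<and> v = poly_eval p x / poly_eval q x)"

lemma ratfun_eval_Fract:
  assumes "poly_eval q x \<noteq> 0"
  shows "ratfun_eval (Fract p q) x = poly_eval p x / poly_eval q x"
  unfolding ratfun_eval_def
proof (rule the_equality)
  show "\<exists>p' q'. Fract p q = Fract p' q' \<and> poly_eval q' x \<noteq> 0 \<and>
      poly_eval p x / poly_eval q x = poly_eval p' x / poly_eval q' x"
    using assms by blast
next
  fix v
  assume "\<exists>p' q'. Fract p q = Fract p' q' \<and> poly_eval q' x \<noteq> 0 \<and> v = poly_eval p' x / poly_eval q' x"
  then obtain p' q' where *: "Fract p q = Fract p' q'" "poly_eval q' x \<noteq> 0"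
    "v = poly_eval p' x / poly_eval q' x"
    by blast
  have "q \<noteq> 0" "q' \<noteq> 0"
    using assms *(2) by auto
  then have "p * q' = p' * q"
    using *(1) by (simp add: eq_fract)
  then have "poly_eval p x * poly_eval q' x = poly_eval p' x * poly_eval q x"
    by (metis poly_eval_mult)
  then show "v = poly_eval p x / poly_eval q x"
    using assms *(2,3) by (simp add: frac_eq_eq)
qed

definition ratmap_domain :: "'n::{finite,linorder} ratmap \<Rightarrow> 'n point set" where
  "ratmap_domain F = {x. \<forall>i. ratfun_defined (F $ i) x}"

definition ratmap_eval :: "'n::{finite,linorder} ratmap \<Rightarrow> 'n point \<Rightarrow> 'n point" where
  "ratmap_eval F x = (\<chi> i. ratfun_eval (F $ i) x)"

definition zariski_closed :: "'n::{finite,linorder} point set \<Rightarrow> bool" where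
  "zariski_closed C \<longleftrightarrow> (\<exists>S. C = {x. \<forall>p\<in>S. poly_eval p x = 0})"

definition zariski_open :: "'n::{finite,linorder} point set \<Rightarrow> bool" where
  "zariski_open U \<longleftrightarrow> zariski_closed (- U)"

definition zariski_dense :: "'n::{finite,linorder} point set \<Rightarrow> bool" where
  "zariski_dense A \<longleftrightarrow> (\<forall>C. zariski_closed C \<and> A \<subseteq> C \<longrightarrow> C = UNIV)"

definition dominant :: "'n::{finite,linorder} ratmap \<Rightarrow> bool" where
  "dominant F \<longleftrightarrow> zariski_dense (ratmap_eval F ` ratmap_domain F)"

text \<open>Infinite sets have cardinality 0, so positivity of \<open>N\<close> forces the fibres to be finite.\<close>

definition has_geometric_degree :: "'n::{finite,linorder} ratmap \<Rightarrow> nat \<Rightarrow> bool" where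
  "has_geometric_degree F N \<longleftrightarrow> N > 0 \<and>
     (\<exists>U. zariski_open U \<and> U \<noteq> {} \<and>
       (\<forall>y\<in>U. card {x \<in> ratmap_domain F. ratmap_eval F x = y} = N))"

abbreviation ratfun_field :: "'n::{finite,linorder} ratfun ring" where
  "ratfun_field \<equiv> ring_of_type_algebra"

definition ratfun_const :: "real \<Rightarrow> 'n::{finite,linorder} ratfun" where
  "ratfun_const c = Fract (Poly_Mapping.single 0 c) 1"

definition component_field :: "'n::{finite,linorder} ratmap \<Rightarrow> 'n ratfun set" where
  "component_field F = generate_field ratfun_field (range ratfun_const \<union> range (\<lambda>i. F $ i))"

text \<open>
  The degree of an extension is the dimension of the larger field over the smaller one. The
  predicate \<open>ring.dimension\<close> holds only for finite-dimensional spaces, so having some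
  degree in the following sense includes finiteness of the extension.
\<close>

definition has_extension_degree :: "('a, 'b) ring_scheme \<Rightarrow> 'a set \<Rightarrow> nat \<Rightarrow> bool" where
  "has_extension_degree L K d \<longleftrightarrow> ring.dimension L d K (carrier L)"

definition field_automorphisms_over :: "('a, 'b) ring_scheme \<Rightarrow> 'a set \<Rightarrow> ('a \<Rightarrow> 'a) set" where
  "field_automorphisms_over L K = {\<sigma> \<in> ring_iso L L. \<forall>x\<in>K. \<sigma> x = x}"

end

theory Submission
  imports Defs
begin

text \<open>
  Write \<open>K = R(F)\<close> for the field generated by the components of \<open>F\<close>. Counting monomials shows that
  \<open>F\<close>, real parameters \<open>u\<close> and \<open>theta u = (\<Sum>k. u k * x k)\<close> satisfy a polynomial relation identically in
  \<open>u\<close>. Differentiating a suitable such relation with respect to the parameters gives, for some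
  \<open>u\<close>, that \<open>theta u\<close> is a separable primitive element of \<open>R(X)\<close> over \<open>K\<close>.

  Since \<open>K\<close> is isomorphic to \<open>R(Y)\<close>, the minimal polynomial of \<open>theta u\<close> can be specialised at a
  generic point \<open>y\<close>. The specialisation has only simple roots, and its real roots correspond to the
  points of the fibre of \<open>F\<close> over \<open>y\<close>. If the fibre is a single point there is exactly one real root, so
  the degree is odd because the remaining cofactor has no real root.

  A \<open>K\<close>-automorphism of \<open>R(X)\<close> is given by a rational map \<open>S\<close> with \<open>F (S x) = F x\<close> for generic
  \<open>x\<close>; generic injectivity of \<open>F\<close> gives \<open>S x = x\<close>.
\<close>

no_notation fps_nth (infixl \<open>$\<close> 75)

section \<open>Evaluation of polynomials in commutative rings\<close>

text \<open>Coefficients pass through an arbitrary map \<open>c\<close>, so one definition covers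
  evaluation at real points, substitution of rational functions and substitution of univariate
  polynomials.\<close>

definition peval :: "(real \<Rightarrow> 'a::comm_ring_1) \<Rightarrow> ('v::finite \<Rightarrow> 'a) \<Rightarrow> 'v rpoly \<Rightarrow> 'a" where
  "peval c v p = (\<Sum>m\<in>Poly_Mapping.keys p.
     c (Poly_Mapping.lookup p m) * (\<Prod>i\<in>UNIV. v i ^ Poly_Mapping.lookup m i))"

definition pvar :: "'v \<Rightarrow> 'v rpoly" where
  "pvar i = Poly_Mapping.single (Poly_Mapping.single i 1) 1"

locale real_hom =
  fixes c :: "real \<Rightarrow> 'a::comm_ring_1"
  assumes hom_1: "c 1 = 1"
    and hom_add: "c (a + b) = c a + c b"
    and hom_mult: "c (a * b) = c a * c b"
begin

lemma hom_0: "c 0 = 0"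
  using hom_add[of 0 0] by simp

lemma peval_superset:
  assumes "finite A" "Poly_Mapping.keys p \<subseteq> A"
  shows "peval c v p = (\<Sum>m\<in>A. c (Poly_Mapping.lookup p m) * (\<Prod>i\<in>UNIV. v i ^ Poly_Mapping.lookup m i))"
  unfolding peval_def
  by (rule sum.mono_neutral_left) (use assms in \<open>auto simp: in_keys_iff hom_0\<close>)

lemma peval_0: "peval c v 0 = 0"
  by (simp add: peval_def)

lemma peval_single:
  "peval c v (Poly_Mapping.single m r) = c r * (\<Prod>i\<in>UNIV. v i ^ Poly_Mapping.lookup m i)"
  by (simp add: peval_superset[of "{m}"])

lemma peval_const: "peval c v (Poly_Mapping.single 0 r) = c r"
  by (simp add: peval_single)

lemma peval_var: "peval c v (pvar i) = v i"
proof -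
  have "(\<Prod>j\<in>UNIV. v j ^ Poly_Mapping.lookup (Poly_Mapping.single i (1::nat)) j) =
      (\<Prod>j\<in>UNIV. if j = i then v j else 1)"
    by (rule prod.cong) (auto simp: lookup_single)
  then show ?thesis
    by (simp add: pvar_def peval_single hom_1)
qed

lemma peval_add: "peval c v (p + q) = peval c v p + peval c v q"
proof -
  let ?A = "Poly_Mapping.keys p \<union> Poly_Mapping.keys q"
  have "Poly_Mapping.keys (p + q) \<subseteq> ?A"
    by (rule Poly_Mapping.keys_add)
  then show ?thesis
    by (simp add: peval_superset[of ?A] lookup_add hom_add algebra_simps sum.distrib)
qed

lemma peval_sum: "peval c v (\<Sum>a\<in>A. f a) = (\<Sum>a\<in>A. peval c v (f a))"
  by (induction A rule: infinite_finite_induct) (auto simp: peval_add peval_0)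

end

lemma poly_mapping_sum_single:
  "(p :: 'v rpoly) = (\<Sum>m\<in>Poly_Mapping.keys p. Poly_Mapping.single m (Poly_Mapping.lookup p m))"
  by (rule poly_mapping_eqI) (auto simp: lookup_sum lookup_single when_def in_keys_iff)

context real_hom
begin

lemma peval_mult: "peval c v (p * q) = peval c v p * peval c v q"
proof -
  let ?s = "\<lambda>p m. Poly_Mapping.single m (Poly_Mapping.lookup p m)"
  have "p * q = (\<Sum>m\<in>Poly_Mapping.keys p. ?s p m) * (\<Sum>m\<in>Poly_Mapping.keys q. ?s q m)"
    by (subst (1 2) poly_mapping_sum_single) (rule refl)
  also have "\<dots> = (\<Sum>m\<in>Poly_Mapping.keys p. \<Sum>l\<in>Poly_Mapping.keys q. ?s p m * ?s q l)"
    by (rule sum_product)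
  finally have "peval c v (p * q) = (\<Sum>m\<in>Poly_Mapping.keys p. \<Sum>l\<in>Poly_Mapping.keys q.
      peval c v (?s p m * ?s q l))"
    by (simp add: peval_sum)
  also have "\<dots> = (\<Sum>m\<in>Poly_Mapping.keys p. \<Sum>l\<in>Poly_Mapping.keys q.
      peval c v (?s p m) * peval c v (?s q l))"
    by (simp add: mult_single peval_single lookup_add power_add prod.distrib hom_mult algebra_simps)
  also have "\<dots> = peval c v p * peval c v q"
    by (simp add: peval_single flip: sum_product) (simp add: peval_def)
  finally show ?thesis .
qed

lemma peval_1: "peval c v 1 = 1"
  using peval_const[of v 1] by (simp add: hom_1)

lemma peval_power: "peval c v (p ^ n) = peval c v p ^ n"
  by (induction n) (simp_all add: peval_1 peval_mult)

lemma peval_prod: "peval c v (\<Prod>a\<in>A. f a) = (\<Prod>a\<in>A. peval c v (f a))"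
  by (induction A rule: infinite_finite_induct) (auto simp: peval_mult peval_1)

end

text \<open>
  Evaluation of a rational function at a point is a ring homomorphism that is only partially
  defined, hence the relational form.
\<close>

locale ring_rel =
  fixes R :: "'a::comm_ring_1 \<Rightarrow> 'b::comm_ring_1 \<Rightarrow> bool"
  assumes rel_0: "R 0 0" and rel_1: "R 1 1"
    and rel_add: "R a b \<Longrightarrow> R a' b' \<Longrightarrow> R (a + a') (b + b')"
    and rel_mult: "R a b \<Longrightarrow> R a' b' \<Longrightarrow> R (a * a') (b * b')"
begin

lemma rel_sum: "(\<And>i. i \<in> A \<Longrightarrow> R (f i) (g i)) \<Longrightarrow> R (\<Sum>i\<in>A. f i) (\<Sum>i\<in>A. g i)"
  by (induction A rule: infinite_finite_induct) (auto intro: rel_0 rel_add)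

lemma rel_prod: "(\<And>i. i \<in> A \<Longrightarrow> R (f i) (g i)) \<Longrightarrow> R (\<Prod>i\<in>A. f i) (\<Prod>i\<in>A. g i)"
  by (induction A rule: infinite_finite_induct) (auto intro: rel_1 rel_mult)

lemma rel_power: "R a b \<Longrightarrow> R (a ^ n) (b ^ n)"
  by (induction n) (auto intro: rel_1 rel_mult)

lemma rel_peval:
  assumes "\<And>r. R (c r) (c' r)" "\<And>i. R (v i) (v' i)"
  shows "R (peval c v p) (peval c' v' p)"
  unfolding peval_def by (intro rel_sum rel_mult rel_prod rel_power assms)

end

lemma peval_hom:
  assumes "\<And>a b. h (a + b) = h a + h b" "\<And>a b. h (a * b) = h a * h b"
    and "h 1 = 1"
  shows "h (peval c v p) = peval (\<lambda>r. h (c r)) (\<lambda>i. h (v i)) p"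
proof -
  have "h 0 = 0"
    using assms(1)[of 0 0] by simp
  interpret ring_rel "\<lambda>a b. h a = b"
    by unfold_locales (use assms \<open>h 0 = 0\<close> in auto)
  show ?thesis
    by (rule rel_peval) auto
qed

interpretation id_hom: real_hom "\<lambda>r. r"
  by unfold_locales auto

lemma poly_eval_peval: "poly_eval p x = peval (\<lambda>r. r) (\<lambda>i. x $ i) p"
  by (simp add: poly_eval_def peval_def)

lemma (in real_hom) peval_peval:
  "peval c v (peval (\<lambda>r. Poly_Mapping.single 0 r) w p) = peval c (\<lambda>i. peval c v (w i)) p"
  by (subst peval_hom[where h = "peval c v"])
    (auto simp: peval_add peval_mult peval_1 peval_const)

section \<open>Partial derivatives\<close>

text \<open>The truncated subtraction of exponents is harmless: where \<open>j\<close> does not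
  occur in \<open>m\<close>, the new coefficient is 0.\<close>

definition pdiff :: "'v::finite \<Rightarrow> 'v rpoly \<Rightarrow> 'v rpoly" where
  "pdiff j p = (\<Sum>m\<in>Poly_Mapping.keys p.
     Poly_Mapping.single (m - Poly_Mapping.single j 1)
       (real (Poly_Mapping.lookup m j) * Poly_Mapping.lookup p m))"

lemma exponent_split:
  fixes m :: "'v \<Rightarrow>\<^sub>0 nat"
  assumes "Poly_Mapping.lookup m j > 0"
  shows "m = (m - Poly_Mapping.single j 1) + Poly_Mapping.single j 1"
  using assms
  by (intro poly_mapping_eqI) (auto simp: lookup_add lookup_minus lookup_single when_def)

lemma lookup_pdiff:
  "Poly_Mapping.lookup (pdiff j p) m =
     (real (Poly_Mapping.lookup m j) + 1) * Poly_Mapping.lookup p (m + Poly_Mapping.single j 1)"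
proof -
  let ?e = "Poly_Mapping.single j (1::nat)"
  have "Poly_Mapping.lookup (pdiff j p) m = (\<Sum>l\<in>Poly_Mapping.keys p.
      if l = m + ?e then real (Poly_Mapping.lookup l j) * Poly_Mapping.lookup p l else 0)"
    unfolding pdiff_def lookup_sum lookup_single when_def
  proof (rule sum.cong[OF refl])
    fix l
    show "(if l - ?e = m then real (Poly_Mapping.lookup l j) * Poly_Mapping.lookup p l else 0) =
      (if l = m + ?e then real (Poly_Mapping.lookup l j) * Poly_Mapping.lookup p l else 0)"
    proof (cases "Poly_Mapping.lookup l j = 0")
      case False
      then show ?thesis
        using exponent_split[of l j] by auto
    qed auto
  qed
  also have "\<dots> = (real (Poly_Mapping.lookup m j) + 1) * Poly_Mapping.lookup p (m + ?e)"
    by (auto simp: in_keys_iff lookup_add)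
  finally show ?thesis .
qed

text \<open>In characteristic 0 a monomial containing \<open>j\<close> survives differentiation with
  a nonzero coefficient.\<close>

lemma pdiff_eq_0D:
  assumes "pdiff j p = 0" "m \<in> Poly_Mapping.keys p"
  shows "Poly_Mapping.lookup m j = 0"
proof (rule ccontr)
  assume "Poly_Mapping.lookup m j \<noteq> 0"
  then have m: "m = (m - Poly_Mapping.single j 1) + Poly_Mapping.single j 1"
    by (intro exponent_split) simp
  have "(real (Poly_Mapping.lookup (m - Poly_Mapping.single j 1) j) + 1) * Poly_Mapping.lookup p m = 0"
    using lookup_pdiff[of j p "m - Poly_Mapping.single j 1"] assms(1) m by simp
  then show False
    using assms(2) by (simp add: in_keys_iff add_nonneg_eq_0_iff)
qed

definition total_degree :: "'v::finite rpoly \<Rightarrow> nat" where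
  "total_degree p = Max (insert 0 ((\<lambda>m. \<Sum>i\<in>UNIV. Poly_Mapping.lookup m i) ` Poly_Mapping.keys p))"

lemma total_degree_pdiff:
  assumes "pdiff j p \<noteq> 0"
  shows "total_degree (pdiff j p) < total_degree p"
proof -
  let ?s = "\<lambda>m::'a \<Rightarrow>\<^sub>0 nat. \<Sum>i\<in>UNIV. Poly_Mapping.lookup m i"
  have *: "?s m < total_degree p" if "m \<in> Poly_Mapping.keys (pdiff j p)" for m
  proof -
    have "m + Poly_Mapping.single j 1 \<in> Poly_Mapping.keys p"
      using that by (auto simp: in_keys_iff lookup_pdiff)
    then have "?s (m + Poly_Mapping.single j 1) \<le> total_degree p"
      unfolding total_degree_def by (intro Max_ge) auto
    moreover have "?s (m + Poly_Mapping.single j 1) = ?s m + 1"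
      by (simp add: lookup_add sum.distrib lookup_single when_def)
    ultimately show ?thesis by simp
  qed
  obtain m where "m \<in> Poly_Mapping.keys (pdiff j p)"
    using assms keys_eq_empty by fastforce
  then have "total_degree p > 0"
    using * by fastforce
  then show ?thesis
    using * unfolding total_degree_def[of "pdiff j p"] by (subst Max_less_iff) auto
qed

text \<open>Descent: a nonzero derivative still satisfies \<open>P\<close> and has smaller total
  degree, so repeated differentiation in the directions \<open>J\<close> must stop.\<close>

lemma minimal_annihilated:
  assumes "P p" "p \<noteq> 0" "\<And>j q. j \<in> J \<Longrightarrow> P q \<Longrightarrow> P (pdiff j q)"
  shows "\<exists>q. P q \<and> q \<noteq> 0 \<and> (\<forall>j\<in>J. pdiff j q = 0)"
  using assms(1,2)
proof (induction "total_degree p" arbitrary: p rule: less_induct)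
  case less
  then show ?case
    using total_degree_pdiff assms(3) by metis
qed

text \<open>Chain rule; the second hypothesis makes the images of the coefficients constants for
  \<open>pderiv\<close>.\<close>

lemma pderiv_peval:
  fixes v :: "'v::finite \<Rightarrow> 'a::idom poly"
  assumes "real_hom c" "\<And>r. pderiv (c r) = 0"
  shows "pderiv (peval c v p) = (\<Sum>j\<in>UNIV. peval c v (pdiff j p) * pderiv (v j))"
proof -
  interpret real_hom c by fact
  have mono: "pderiv (\<Prod>i\<in>UNIV. v i ^ Poly_Mapping.lookup m i) =
      (\<Sum>j\<in>UNIV. of_nat (Poly_Mapping.lookup m j) *
        (\<Prod>i\<in>UNIV. v i ^ Poly_Mapping.lookup (m - Poly_Mapping.single j 1) i) * pderiv (v j))" for m
    unfolding pderiv_prod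
  proof (rule sum.cong[OF refl])
    fix j
    have "(\<Prod>i\<in>UNIV. v i ^ Poly_Mapping.lookup (m - Poly_Mapping.single j 1) i) =
       v j ^ (Poly_Mapping.lookup m j - 1) * (\<Prod>i\<in>UNIV - {j}. v i ^ Poly_Mapping.lookup m i)"
      by (subst prod.remove[of _ j])
        (auto simp: lookup_minus lookup_single intro!: prod.cong)
    then show "(\<Prod>i\<in>UNIV - {j}. v i ^ Poly_Mapping.lookup m i) * pderiv (v j ^ Poly_Mapping.lookup m j) =
      of_nat (Poly_Mapping.lookup m j) *
        (\<Prod>i\<in>UNIV. v i ^ Poly_Mapping.lookup (m - Poly_Mapping.single j 1) i) * pderiv (v j)"
      by (simp add: pderiv_power of_nat_poly algebra_simps)
  qed
  have of_nat: "c (real n) = of_nat n" for n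
    by (induction n) (auto simp: hom_0 hom_1 hom_add)
  have "pderiv (peval c v p) = (\<Sum>m\<in>Poly_Mapping.keys p. c (Poly_Mapping.lookup p m) *
      pderiv (\<Prod>i\<in>UNIV. v i ^ Poly_Mapping.lookup m i))"
    unfolding peval_def
    by (subst additive.sum[of pderiv]) (auto simp: additive_def pderiv_add pderiv_mult assms(2))
  also have "\<dots> = (\<Sum>j\<in>UNIV. (\<Sum>m\<in>Poly_Mapping.keys p. c (Poly_Mapping.lookup p m) *
      of_nat (Poly_Mapping.lookup m j) *
        (\<Prod>i\<in>UNIV. v i ^ Poly_Mapping.lookup (m - Poly_Mapping.single j 1) i)) * pderiv (v j))"
    unfolding mono sum_distrib_left sum_distrib_right
    by (subst sum.swap) (simp add: algebra_simps)
  also have "\<dots> = (\<Sum>j\<in>UNIV. peval c v (pdiff j p) * pderiv (v j))"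
    unfolding pdiff_def peval_sum peval_single
    by (simp add: hom_mult of_nat algebra_simps)
  finally show ?thesis .
qed

section \<open>Algebraic dependence\<close>

text \<open>Gaussian elimination for a system with more unknowns than equations: each induction step
  uses one equation to eliminate one unknown.\<close>

lemma homogeneous_system_nontrivial:
  fixes A :: "'m \<Rightarrow> 'e \<Rightarrow> 'a::field"
  assumes "finite E" "finite M" "card E < card M"
  shows "\<exists>a. (\<exists>m\<in>M. a m \<noteq> 0) \<and> (\<forall>e\<in>E. (\<Sum>m\<in>M. a m * A m e) = 0)"
  using assms
proof (induction E arbitrary: M A rule: finite_induct)
  case empty
  then obtain m where "m \<in> M"
    by (metis card.empty card_gt_0_iff ex_in_conv)
  then show ?case
    by (intro exI[of _ "\<lambda>_. 1"]) auto
next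
  case (insert e E)
  show ?case
  proof (cases "\<forall>m\<in>M. A m e = 0")
    case True
    have "card E < card M"
      using insert by simp
    then obtain a where "\<exists>m\<in>M. a m \<noteq> 0" "\<forall>e\<in>E. (\<Sum>m\<in>M. a m * A m e) = 0"
      using insert.IH insert.prems by blast
    then show ?thesis
      using True by (intro exI[of _ a]) auto
  next
    case False
    then obtain m0 where m0: "m0 \<in> M" "A m0 e \<noteq> 0"
      by blast
    define M' where "M' = M - {m0}"
    have M': "finite M'" "m0 \<notin> M'" "M = insert m0 M'" "card E < card M'"
      using insert m0 by (auto simp: M'_def)
    obtain a where a: "\<exists>m\<in>M'. a m \<noteq> 0"
      "\<And>f. f \<in> E \<Longrightarrow> (\<Sum>m\<in>M'. a m * (A m f - A m e / A m0 e * A m0 f)) = 0"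
      using insert.IH[OF M'(1,4), of "\<lambda>m f. A m f - A m e / A m0 e * A m0 f"] by blast
    \<comment> \<open>Equation \<open>e\<close> determines the pivot unknown: with the value
      \<open>- s\<close> at \<open>m0\<close> it holds, and every other equation turns into the
      reduced one.\<close>
    define s where "s = (\<Sum>m\<in>M'. a m * A m e) / A m0 e"
    define b where "b = a(m0 := - s)"
    have b: "(\<Sum>m\<in>M. b m * A m f) = (\<Sum>m\<in>M'. a m * A m f) - s * A m0 f" for f
    proof -
      have "(\<Sum>m\<in>M'. b m * A m f) = (\<Sum>m\<in>M'. a m * A m f)"
        using M'(2) by (intro sum.cong) (auto simp: b_def)
      then show ?thesis
        using M' by (simp add: b_def)
    qed
    have "(\<Sum>m\<in>M. b m * A m f) = 0" if "f \<in> E" for f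
    proof -
      have "(\<Sum>m\<in>M'. a m * A m f) - s * A m0 f =
          (\<Sum>m\<in>M'. a m * (A m f - A m e / A m0 e * A m0 f))"
        by (simp add: s_def algebra_simps sum_subtractf sum_distrib_left sum_divide_distrib)
      then show ?thesis
        using a(2)[OF that] b by simp
    qed
    moreover have "(\<Sum>m\<in>M. b m * A m e) = 0"
      using m0 by (simp add: b s_def)
    moreover have "\<exists>m\<in>M. b m \<noteq> 0"
      using a(1) M' by (auto simp: b_def)
    ultimately show ?thesis
      by (intro exI[of _ b]) auto
  qed
qed

text \<open>Bounding each exponent separately, instead of the total degree, makes the number of
  monomials an exact power and is additive under multiplication.\<close>

definition exponent_box :: "nat \<Rightarrow> ('v::finite \<Rightarrow>\<^sub>0 nat) set" where
  "exponent_box k = {m. \<forall>i. Poly_Mapping.lookup m i \<le> k}"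

lemma exponent_box: "finite (exponent_box k :: ('v::finite \<Rightarrow>\<^sub>0 nat) set)"
  "card (exponent_box k :: ('v \<Rightarrow>\<^sub>0 nat) set) = (k + 1) ^ CARD('v)"
proof -
  have *: "bij_betw Poly_Mapping.lookup (exponent_box k :: ('v \<Rightarrow>\<^sub>0 nat) set)
      (PiE UNIV (\<lambda>_. {..k}))"
  proof (rule bij_betwI[where g = Abs_poly_mapping])
    show "Poly_Mapping.lookup \<in> (exponent_box k :: ('v \<Rightarrow>\<^sub>0 nat) set) \<rightarrow> PiE UNIV (\<lambda>_. {..k})"
      by (auto simp: exponent_box_def)
    show "Abs_poly_mapping \<in> PiE UNIV (\<lambda>_. {..k}) \<rightarrow> (exponent_box k :: ('v \<Rightarrow>\<^sub>0 nat) set)"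
      by (auto simp: exponent_box_def PiE_def Pi_def)
  qed (auto simp: lookup_inverse)
  have "finite (PiE (UNIV :: 'v set) (\<lambda>_. {..k}))"
    by (intro finite_PiE) auto
  then show "finite (exponent_box k :: ('v \<Rightarrow>\<^sub>0 nat) set)"
    using bij_betw_finite[OF *] by simp
  show "card (exponent_box k :: ('v \<Rightarrow>\<^sub>0 nat) set) = (k + 1) ^ CARD('v)"
    using bij_betw_same_card[OF *] by (simp add: card_PiE)
qed

definition in_box :: "'v::finite rpoly \<Rightarrow> nat \<Rightarrow> bool" where
  "in_box p k \<longleftrightarrow> Poly_Mapping.keys p \<subseteq> exponent_box k"

lemma in_box_mono: "in_box p k \<Longrightarrow> k \<le> l \<Longrightarrow> in_box p l"
  unfolding in_box_def exponent_box_def using order_trans by blast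

lemma in_box_exists: "\<exists>k. in_box p k"
proof (intro exI)
  have "Poly_Mapping.lookup m i \<le> (\<Sum>m\<in>Poly_Mapping.keys p. \<Sum>i\<in>UNIV. Poly_Mapping.lookup m i)"
    if "m \<in> Poly_Mapping.keys p" for m i
  proof -
    have "Poly_Mapping.lookup m i \<le> (\<Sum>i\<in>UNIV. Poly_Mapping.lookup m i)"
      by (rule member_le_sum) auto
    also have "\<dots> \<le> (\<Sum>m\<in>Poly_Mapping.keys p. \<Sum>i\<in>UNIV. Poly_Mapping.lookup m i)"
      using that by (intro member_le_sum[of m _ "\<lambda>m. \<Sum>i\<in>UNIV. Poly_Mapping.lookup m i"]) auto
    finally show ?thesis .
  qed
  then show "in_box p (\<Sum>m\<in>Poly_Mapping.keys p. \<Sum>i\<in>UNIV. Poly_Mapping.lookup m i)"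
    by (auto simp: in_box_def exponent_box_def)
qed

lemma in_box_1: "in_box 1 0"
  by (auto simp: in_box_def exponent_box_def)

lemma in_box_mult: "in_box p k \<Longrightarrow> in_box q l \<Longrightarrow> in_box (p * q) (k + l)"
  using keys_mult[of p q]
  by (fastforce simp: in_box_def exponent_box_def lookup_add intro: add_mono)

lemma in_box_power: "in_box p k \<Longrightarrow> in_box (p ^ n) (k * n)"
  by (induction n) (auto simp: in_box_1 in_box_mult)

lemma in_box_prod: "(\<And>i. i \<in> A \<Longrightarrow> in_box (f i) (k i)) \<Longrightarrow> in_box (\<Prod>i\<in>A. f i) (\<Sum>i\<in>A. k i)"
  by (induction A rule: infinite_finite_induct) (auto simp: in_box_1 in_box_mult)

lemma lookup_single_0_mult:
  "Poly_Mapping.lookup (Poly_Mapping.single 0 s * p) k = s * Poly_Mapping.lookup (p :: 'v rpoly) k"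
proof -
  have "Poly_Mapping.lookup (Poly_Mapping.map ((*) s) p) k = s * Poly_Mapping.lookup p k"
    by (simp add: Poly_Mapping.map.rep_eq when_def)
  then show ?thesis
    by (simp add: mult_map_scale_conv_mult)
qed

text \<open>
  Monomials in the fractions \<open>p j / q\<close> with exponents at most \<open>D\<close>, multiplied by a fixed power
  of \<open>q\<close>: there are \<open>(D + 1) ^ CARD('v)\<close> of them, in a space of dimension of order
  \<open>D ^ CARD('w)\<close>.
\<close>

lemma algebraic_dependence:
  fixes p :: "'v::finite \<Rightarrow> 'w::finite rpoly" and q :: "'w rpoly"
  assumes "CARD('w) < CARD('v)"
  obtains \<Phi> :: "'v rpoly" where "\<Phi> \<noteq> 0"
    and "\<And>c w (g :: 'v \<Rightarrow> 'a::idom). real_hom c \<Longrightarrow> peval c w q \<noteq> 0 \<Longrightarrow>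
      (\<And>j. peval c w q * g j = peval c w (p j)) \<Longrightarrow> peval c g \<Phi> = 0"
proof -
  obtain kq where kq: "in_box q kq"
    using in_box_exists by blast
  have "\<forall>j. \<exists>k. in_box (p j) k"
    using in_box_exists by blast
  then obtain kp where kp: "\<And>j. in_box (p j) (kp j)"
    by metis
  define C where "C = kq + (\<Sum>j\<in>UNIV. kp j)"
  have q: "in_box q C"
    using kq by (rule in_box_mono) (simp add: C_def)
  have p: "in_box (p j) C" for j
    using kp[of j] by (rule in_box_mono) (simp add: C_def member_le_sum trans_le_add2)
  \<comment> \<open>These choices give \<open>C * N + 1 \<le> k * (D + 1)\<close>. Raised to the
    power \<open>CARD('w)\<close>, the factor \<open>k\<close> contributes exactly \<open>D\<close>,
    which is less than the extra factor \<open>D + 1\<close> available on the side of the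
    unknowns.\<close>
  define k where "k = C * CARD('v) + 1"
  define D where "D = k ^ CARD('w)"
  define N where "N = CARD('v) * D"
  define h where "h = (\<lambda>m :: 'v \<Rightarrow>\<^sub>0 nat. (\<Prod>j\<in>UNIV. p j ^ Poly_Mapping.lookup m j) *
    q ^ (N - (\<Sum>j\<in>UNIV. Poly_Mapping.lookup m j)))"
  let ?M = "exponent_box D :: ('v \<Rightarrow>\<^sub>0 nat) set"
  let ?E = "exponent_box (C * N) :: ('w \<Rightarrow>\<^sub>0 nat) set"
  have sum_le: "(\<Sum>j\<in>UNIV. Poly_Mapping.lookup m j) \<le> N" if "m \<in> ?M" for m
    using sum_bounded_above[of UNIV "Poly_Mapping.lookup m" D] that
    by (simp add: exponent_box_def N_def)
  have h: "in_box (h m) (C * N)" if "m \<in> ?M" for m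
  proof -
    have "in_box (h m) ((\<Sum>j\<in>UNIV. C * Poly_Mapping.lookup m j) +
        C * (N - (\<Sum>j\<in>UNIV. Poly_Mapping.lookup m j)))"
      unfolding h_def by (intro in_box_mult in_box_prod in_box_power p q)
    moreover have "(\<Sum>j\<in>UNIV. C * Poly_Mapping.lookup m j) +
        C * (N - (\<Sum>j\<in>UNIV. Poly_Mapping.lookup m j)) = C * N"
      using sum_le[OF that] by (simp flip: sum_distrib_left add_mult_distrib2)
    ultimately show ?thesis by simp
  qed
  have "C * N + 1 \<le> k * (D + 1)"
    by (simp add: k_def N_def algebra_simps)
  then have "(C * N + 1) ^ CARD('w) \<le> (k * (D + 1)) ^ CARD('w)"
    by (intro power_mono) auto
  also have "\<dots> = D * (D + 1) ^ CARD('w)"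
    by (simp only: power_mult_distrib flip: D_def)
  also have "\<dots> < (D + 1) ^ Suc (CARD('w))"
    by simp
  also have "\<dots> \<le> (D + 1) ^ CARD('v)"
    using assms by (intro power_increasing) auto
  finally have "card ?E < card ?M"
    by (simp add: exponent_box)
  then obtain a where a: "\<exists>m\<in>?M. a m \<noteq> 0"
    "\<And>e. e \<in> ?E \<Longrightarrow> (\<Sum>m\<in>?M. a m * Poly_Mapping.lookup (h m) e) = 0"
    using homogeneous_system_nontrivial[OF exponent_box(1) exponent_box(1),
        of "C * N" D "\<lambda>m e. Poly_Mapping.lookup (h m) e"] by metis
  define \<Phi> where "\<Phi> = (\<Sum>m\<in>?M. Poly_Mapping.single m (a m))"
  have lookup: "Poly_Mapping.lookup \<Phi> m = (if m \<in> ?M then a m else 0)" for m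
    by (simp add: \<Phi>_def lookup_sum lookup_single when_def exponent_box)
  show thesis
  proof (rule that)
    show "\<Phi> \<noteq> 0"
      using a(1) lookup by (metis lookup_zero)
    have zero: "(\<Sum>m\<in>?M. Poly_Mapping.single 0 (a m) * h m) = 0"
    proof (rule poly_mapping_eqI)
      fix e
      show "Poly_Mapping.lookup (\<Sum>m\<in>?M. Poly_Mapping.single 0 (a m) * h m) e = Poly_Mapping.lookup 0 e"
      proof (cases "e \<in> ?E")
        case True
        then show ?thesis
          using a(2) by (simp add: lookup_sum lookup_single_0_mult)
      next
        case False
        then have "Poly_Mapping.lookup (h m) e = 0" if "m \<in> ?M" for m
          using h[OF that] by (auto simp: in_box_def in_keys_iff)
        then show ?thesis
          by (simp add: lookup_sum lookup_single_0_mult)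
      qed
    qed
    \<comment> \<open>The relation was found inside the polynomial ring and is evaluated only now,
      so a single \<open>\<Phi>\<close> serves all \<open>c\<close>, \<open>w\<close> and
      \<open>g\<close>.\<close>
    fix c :: "real \<Rightarrow> 'a" and w and g :: "'v \<Rightarrow> 'a"
    assume "real_hom c" and Q: "peval c w q \<noteq> 0"
      and g: "\<And>j. peval c w q * g j = peval c w (p j)"
    interpret real_hom c by fact
    have hm: "peval c w (h m) = peval c w q ^ N * (\<Prod>j\<in>UNIV. g j ^ Poly_Mapping.lookup m j)"
      if "m \<in> ?M" for m
    proof -
      let ?s = "\<Sum>j\<in>UNIV. Poly_Mapping.lookup m j"
      have "peval c w (h m) = (\<Prod>j\<in>UNIV. (peval c w q * g j) ^ Poly_Mapping.lookup m j) *
          peval c w q ^ (N - ?s)"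
        by (simp add: h_def peval_mult peval_prod peval_power g)
      also have "\<dots> = peval c w q ^ (?s + (N - ?s)) * (\<Prod>j\<in>UNIV. g j ^ Poly_Mapping.lookup m j)"
        by (simp add: power_mult_distrib prod.distrib power_sum power_add)
      finally show ?thesis
        using sum_le[OF that] by simp
    qed
    have "0 = peval c w (\<Sum>m\<in>?M. Poly_Mapping.single 0 (a m) * h m)"
      by (simp add: zero peval_0)
    also have "\<dots> = peval c w q ^ N * (\<Sum>m\<in>?M. c (a m) * (\<Prod>j\<in>UNIV. g j ^ Poly_Mapping.lookup m j))"
      by (simp add: peval_sum peval_mult peval_const hm sum_distrib_left mult.left_commute)
    also have "(\<Sum>m\<in>?M. c (a m) * (\<Prod>j\<in>UNIV. g j ^ Poly_Mapping.lookup m j)) = peval c g \<Phi>"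
      using lookup by (subst peval_superset[of ?M]) (auto simp: exponent_box in_keys_iff split: if_splits)
    finally show "peval c g \<Phi> = 0"
      using Q by simp
  qed
qed

section \<open>Polynomials that vanish at all real arguments\<close>

lemma poly_eq_0_if_vanishes_on_reals:
  fixes P :: "'a::idom poly"
  assumes "inj c" "\<And>r::real. poly P (c r) = 0"
  shows "P = 0"
proof (rule ccontr)
  assume "P \<noteq> 0"
  then have "finite {x. poly P x = 0}"
    by (rule poly_roots_finite)
  then have "finite (range c)"
    by (rule finite_subset[rotated]) (use assms in auto)
  then show False
    using assms(1) infinite_UNIV_char_0 finite_imageD by blast
qed

text \<open>A nonzero real is a unit, so its image cannot be 0.\<close>

lemma real_hom_inj:
  fixes c :: "real \<Rightarrow> 'a::idom"
  assumes "real_hom c"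
  shows "inj c"
proof (rule injI, rule ccontr)
  interpret real_hom c by fact
  fix a b
  assume "c a = c b" "a \<noteq> b"
  have "c (a - b) + c b = c a"
    by (simp flip: hom_add)
  then have "c (a - b) = 0"
    using \<open>c a = c b\<close> by simp
  moreover have "c (a - b) * c (1 / (a - b)) = 1"
    using \<open>a \<noteq> b\<close> by (simp add: hom_1 flip: hom_mult)
  ultimately show False by simp
qed

lemma real_hom_const_poly: "real_hom c \<Longrightarrow> real_hom (\<lambda>r. [:c r:])"
  by (auto simp: real_hom_def)

text \<open>Restricting \<open>p\<close> to the line through \<open>v\<close> in direction
  \<open>d\<close> gives a univariate polynomial with infinitely many roots. It is therefore 0, and
  its derivative at 0 is the sum in question by the chain rule.\<close>

lemma directional_derivative_vanishes:
  fixes v d :: "'v::finite \<Rightarrow> 'a::idom"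
  assumes "real_hom c" "\<And>r. peval c (\<lambda>j. v j + c r * d j) p = 0"
  shows "(\<Sum>j\<in>UNIV. peval c v (pdiff j p) * d j) = 0"
proof -
  interpret real_hom c by fact
  interpret C: real_hom "\<lambda>r. [:c r:]"
    by (rule real_hom_const_poly) fact
  define P where "P = peval (\<lambda>r. [:c r:]) (\<lambda>j. [:v j, d j:]) p"
  have eval: "poly (peval (\<lambda>r. [:c r:]) (\<lambda>j. [:v j, d j:]) q) t = peval c (\<lambda>j. v j + t * d j) q" for q t
    by (subst peval_hom[where h = "\<lambda>p. poly p t"]) auto
  have "P = 0"
    using poly_eq_0_if_vanishes_on_reals[OF real_hom_inj[OF assms(1)], of P] assms(2)
    by (simp add: P_def eval)
  then have "0 = poly (pderiv P) 0"
    by simp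
  also have "\<dots> = (\<Sum>j\<in>UNIV. peval c v (pdiff j p) * d j)"
    unfolding P_def by (subst pderiv_peval) (auto simp: C.real_hom_axioms poly_sum eval pderiv_pCons mult.commute)
  finally show ?thesis by simp
qed

text \<open>If \<open>p\<close> vanished everywhere, so would all its iterated derivatives. Descent
  would then produce a nonzero polynomial with all partial derivatives 0, that is, a nonzero
  constant, which still vanishes everywhere.\<close>

lemma peval_nonzero_exists:
  fixes p :: "'v::finite rpoly"
  assumes "p \<noteq> 0"
  obtains x where "peval (\<lambda>r. r) x p \<noteq> 0"
proof (rule ccontr)
  assume "\<not> thesis"
  then have "\<forall>x. peval (\<lambda>r. r) x p = 0"
    using that by blast
  moreover have "\<forall>x. peval (\<lambda>r. r) x (pdiff j q) = 0" if "\<forall>x. peval (\<lambda>r. r) x q = 0" for j and q :: "'v rpoly"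
  proof
    fix x :: "'v \<Rightarrow> real"
    show "peval (\<lambda>r. r) x (pdiff j q) = 0"
      using directional_derivative_vanishes[of "\<lambda>r. r" x "\<lambda>i. if i = j then 1 else 0" q] that
      by (simp add: id_hom.real_hom_axioms if_distrib cong: if_cong)
  qed
  ultimately obtain q :: "'v rpoly" where q: "\<forall>x. peval (\<lambda>r. r) x q = 0" "q \<noteq> 0" "\<forall>j. pdiff j q = 0"
    using minimal_annihilated[of "\<lambda>q. \<forall>x. peval (\<lambda>r. r) x q = 0" p UNIV] assms by auto
  have "m = 0" if "m \<in> Poly_Mapping.keys q" for m
    using pdiff_eq_0D[OF _ that] q(3) by (intro poly_mapping_eqI) auto
  then have "Poly_Mapping.keys q \<subseteq> {0}"
    by blast
  then have "peval (\<lambda>r. r) (\<lambda>_. 0) q = Poly_Mapping.lookup q 0" "Poly_Mapping.lookup q 0 \<noteq> 0"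
    using q(2) by (auto simp: id_hom.peval_superset[of "{0}"] simp flip: in_keys_iff)
       (metis keys_eq_empty subset_singletonD insertI1)
  then show False
    using q(1) by simp
qed

section \<open>Values of rational functions\<close>

lemma pvar_power: "pvar i ^ k = Poly_Mapping.single (Poly_Mapping.single i k) 1"
proof (induction k)
  case (Suc k)
  then show ?case
    by (simp add: pvar_def mult_single flip: single_add)
qed simp

lemma prod_pvar_power:
  fixes m :: "'v::finite \<Rightarrow>\<^sub>0 nat"
  shows "(\<Prod>i\<in>UNIV. pvar i ^ Poly_Mapping.lookup m i) = Poly_Mapping.single m 1"
proof -
  have "(\<Prod>i\<in>A. pvar i ^ Poly_Mapping.lookup m i) =
      Poly_Mapping.single (\<Sum>i\<in>A. Poly_Mapping.single i (Poly_Mapping.lookup m i)) 1" for A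
    by (induction A rule: infinite_finite_induct) (auto simp: pvar_power mult_single)
  moreover have "(\<Sum>i\<in>UNIV. Poly_Mapping.single i (Poly_Mapping.lookup m i)) = m"
    by (rule poly_mapping_eqI) (simp add: lookup_sum lookup_single when_def)
  ultimately show ?thesis by simp
qed

lemma peval_pvar: "peval (\<lambda>r. Poly_Mapping.single 0 r) pvar p = p"
proof -
  have "peval (\<lambda>r. Poly_Mapping.single 0 r) pvar p =
      (\<Sum>m\<in>Poly_Mapping.keys p. Poly_Mapping.single m (Poly_Mapping.lookup p m))"
    unfolding peval_def by (simp add: prod_pvar_power mult_single)
  then show ?thesis
    by (simp flip: poly_mapping_sum_single)
qed

definition ratfun_var :: "'n::{finite,linorder} \<Rightarrow> 'n ratfun" where
  "ratfun_var i = Fract (pvar i) 1"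

interpretation ratfun_const: real_hom ratfun_const
  by unfold_locales
    (auto simp: ratfun_const_def single_add mult_single simp flip: One_fract_def)

text \<open>Writes an embedded polynomial as a substitution, so that homomorphisms can be pushed
  through it with \<open>peval_hom\<close>.\<close>

lemma peval_ratfun_var: "peval ratfun_const ratfun_var p = Fract p 1"
proof -
  have "Fract (peval (\<lambda>r. Poly_Mapping.single 0 r) pvar p) 1 =
      peval (\<lambda>r. Fract (Poly_Mapping.single 0 r) 1) (\<lambda>i. Fract (pvar i) 1) p"
    by (rule peval_hom) (auto simp flip: One_fract_def)
  then show ?thesis
    by (simp add: peval_pvar ratfun_var_def[abs_def] ratfun_const_def[abs_def])
qed

text \<open>The relational form carries definedness along with the value, so that values add and
  multiply without side conditions.\<close>

definition has_value :: "'n::{finite,linorder} ratfun \<Rightarrow> 'n point \<Rightarrow> real \<Rightarrow> bool" where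
  "has_value r x v \<longleftrightarrow> ratfun_defined r x \<and> ratfun_eval r x = v"

lemma has_value_unique: "has_value r x v \<Longrightarrow> has_value r x w \<Longrightarrow> v = w"
  by (auto simp: has_value_def)

lemma has_value_iff:
  "has_value r x v \<longleftrightarrow> (\<exists>p q. r = Fract p q \<and> poly_eval q x \<noteq> 0 \<and> v = poly_eval p x / poly_eval q x)"
  unfolding has_value_def ratfun_defined_def using ratfun_eval_Fract by metis

lemma has_value_Fract:
  "poly_eval q x \<noteq> 0 \<Longrightarrow> has_value (Fract p q) x (poly_eval p x / poly_eval q x)"
  by (auto simp: has_value_iff)

lemma poly_eval_single_0: "poly_eval (Poly_Mapping.single 0 r) x = r"
  by (simp add: poly_eval_single)

lemma poly_eval_1: "poly_eval 1 x = 1"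
  by (simp add: poly_eval_single flip: single_one)

lemma has_value_const: "has_value (ratfun_const r) x r"
  using has_value_Fract[of 1 x "Poly_Mapping.single 0 r"]
  by (simp add: ratfun_const_def poly_eval_single_0 poly_eval_1)

lemma has_value_var: "has_value (ratfun_var i) x (x $ i)"
proof -
  have "poly_eval (pvar i) x = x $ i"
    by (simp add: poly_eval_peval id_hom.peval_var)
  then show ?thesis
    using has_value_Fract[of 1 x "pvar i"] by (simp add: ratfun_var_def poly_eval_1)
qed

interpretation has_value: ring_rel "\<lambda>r v. has_value r x v"
proof
  show "has_value 0 x 0"
    using has_value_const[of 0 x] by (simp add: ratfun_const.hom_0)
  show "has_value 1 x 1"
    using has_value_const[of 1 x] by (simp add: ratfun_const.hom_1)
  fix a b v w
  assume "has_value a x v" "has_value b x w"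
  then obtain p q p' q' where *: "a = Fract p q" "poly_eval q x \<noteq> 0" "v = poly_eval p x / poly_eval q x"
    "b = Fract p' q'" "poly_eval q' x \<noteq> 0" "w = poly_eval p' x / poly_eval q' x"
    unfolding has_value_iff by blast
  have nz: "q \<noteq> 0" "q' \<noteq> 0"
    using * by auto
  have "poly_eval (q * q') x \<noteq> 0"
    using * by (simp add: poly_eval_mult)
  then have "has_value (Fract (p * q' + p' * q) (q * q')) x (poly_eval (p * q' + p' * q) x / poly_eval (q * q') x)"
    "has_value (Fract (p * p') (q * q')) x (poly_eval (p * p') x / poly_eval (q * q') x)"
    by (auto intro: has_value_Fract)
  then show "has_value (a + b) x (v + w)" "has_value (a * b) x (v * w)"
    using * nz by (simp_all add: poly_eval_mult poly_eval_add add_frac_eq)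
qed

lemma has_value_inverse:
  assumes "has_value r x v" "v \<noteq> 0"
  shows "has_value (inverse r) x (inverse v)"
proof -
  obtain p q where *: "r = Fract p q" "poly_eval q x \<noteq> 0" "v = poly_eval p x / poly_eval q x"
    using assms(1) unfolding has_value_iff by blast
  have "poly_eval p x \<noteq> 0"
    using * assms(2) by auto
  then show ?thesis
    using has_value_Fract[of p x q] * by simp
qed

lemma has_value_divide:
  assumes "has_value r x v" "has_value s x w" "w \<noteq> 0"
  shows "has_value (r / s) x (v / w)"
  using has_value.rel_mult[OF assms(1) has_value_inverse[OF assms(2,3)]]
  by (simp add: field_simps)

section \<open>Generic points\<close>

text \<open>As a filter, this lets any finite number of generic conditions be imposed at once;
  closure under conjunction comes from multiplying the two polynomials.\<close>

definition generic :: "'n::{finite,linorder} point filter" where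
  "generic = Abs_filter (\<lambda>P. \<exists>q. q \<noteq> 0 \<and> (\<forall>x. poly_eval q x \<noteq> 0 \<longrightarrow> P x))"

lemma eventually_generic:
  "eventually P generic \<longleftrightarrow> (\<exists>q. q \<noteq> 0 \<and> (\<forall>x. poly_eval q x \<noteq> 0 \<longrightarrow> P x))"
  unfolding generic_def
proof (rule eventually_Abs_filter, rule is_filter.intro)
  show "\<exists>q. q \<noteq> 0 \<and> (\<forall>x. poly_eval q x \<noteq> 0 \<longrightarrow> True)"
    by (intro exI[of _ 1]) auto
  fix P Q :: "'a point \<Rightarrow> bool"
  {
    assume "\<exists>q. q \<noteq> 0 \<and> (\<forall>x. poly_eval q x \<noteq> 0 \<longrightarrow> P x)" "\<exists>q. q \<noteq> 0 \<and> (\<forall>x. poly_eval q x \<noteq> 0 \<longrightarrow> Q x)"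
    then obtain p q where "p \<noteq> 0" "\<forall>x. poly_eval p x \<noteq> 0 \<longrightarrow> P x" "q \<noteq> 0" "\<forall>x. poly_eval q x \<noteq> 0 \<longrightarrow> Q x"
      by blast
    then show "\<exists>q. q \<noteq> 0 \<and> (\<forall>x. poly_eval q x \<noteq> 0 \<longrightarrow> P x \<and> Q x)"
      by (intro exI[of _ "p * q"]) (auto simp: poly_eval_mult)
  }
  show "\<exists>q. q \<noteq> 0 \<and> (\<forall>x. poly_eval q x \<noteq> 0 \<longrightarrow> Q x)"
    if "\<forall>x. P x \<longrightarrow> Q x" "\<exists>q. q \<noteq> 0 \<and> (\<forall>x. poly_eval q x \<noteq> 0 \<longrightarrow> P x)"
    using that by blast
qed

lemma eventually_poly_eval_nonzero: "q \<noteq> 0 \<Longrightarrow> eventually (\<lambda>x. poly_eval q x \<noteq> 0) generic"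
  by (auto simp: eventually_generic)

lemma poly_eval_nonzero_exists:
  assumes "p \<noteq> 0"
  obtains x where "poly_eval p x \<noteq> 0"
proof -
  obtain v where "peval (\<lambda>r. r) v p \<noteq> 0"
    using peval_nonzero_exists[OF assms] .
  then have "poly_eval p (\<chi> i. v i) \<noteq> 0"
    by (simp add: poly_eval_peval)
  then show thesis ..
qed

text \<open>This is what allows an actual point to be chosen that meets given generic
  conditions.\<close>

lemma generic_neq_bot: "generic \<noteq> bot"
proof
  assume "generic = (bot :: 'a point filter)"
  then have "eventually (\<lambda>x :: 'a point. False) generic"
    by simp
  then obtain q :: "'a rpoly" where "q \<noteq> 0" "\<forall>x. \<not> poly_eval q x \<noteq> 0"
    unfolding eventually_generic by blast
  then show False
    using poly_eval_nonzero_exists by metis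
qed

lemma eventually_defined: "eventually (\<lambda>x. ratfun_defined r x) generic"
proof (cases r rule: Fract_cases)
  case (Fract p q)
  then show ?thesis
    using eventually_poly_eval_nonzero[of q]
    by (auto elim!: eventually_mono simp: ratfun_defined_def)
qed

lemma eventually_ratmap_domain: "eventually (\<lambda>x. x \<in> ratmap_domain F) generic"
  unfolding ratmap_domain_def mem_Collect_eq
  by (intro eventually_all_finite eventually_defined)

text \<open>The negated form also holds where \<open>r\<close> is undefined; together with a known
  value of \<open>r\<close> it says that this value is nonzero.\<close>

lemma eventually_value_nonzero:
  assumes "r \<noteq> 0"
  shows "eventually (\<lambda>x. \<not> has_value r x 0) generic"
proof (cases r rule: Fract_cases)
  case (Fract p q)
  have "p \<noteq> 0"
    using assms Fract by (auto simp: fract_collapse)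
  then have "eventually (\<lambda>x. poly_eval p x \<noteq> 0) generic" "eventually (\<lambda>x. poly_eval q x \<noteq> 0) generic"
    using Fract(2) by (auto intro: eventually_poly_eval_nonzero)
  then show ?thesis
  proof eventually_elim
    case (elim x)
    then have "has_value r x (poly_eval p x / poly_eval q x)"
      unfolding Fract(1) by (intro has_value_Fract)
    then show ?case
      using elim has_value_unique by fastforce
  qed
qed

lemma ratfun_eqI:
  assumes "eventually (\<lambda>x. \<exists>v. has_value r x v \<and> has_value s x v) generic"
  shows "r = s"
proof (rule ccontr)
  assume "r \<noteq> s"
  \<comment> \<open>The difference is built from a sum and a product because these are the
    operations that \<open>ring_rel\<close> transports.\<close>
  let ?d = "r + ratfun_const (-1) * s"
  have "ratfun_const (-1) + ratfun_const 1 = (0 :: 'a ratfun)"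
    by (simp add: ratfun_const.hom_0 flip: ratfun_const.hom_add)
  then have "ratfun_const (-1) = (-1 :: 'a ratfun)"
    by (simp add: ratfun_const.hom_1 eq_neg_iff_add_eq_0)
  then have "?d \<noteq> 0"
    using \<open>r \<noteq> s\<close> by simp
  then have "eventually (\<lambda>x. \<not> has_value ?d x 0) generic"
    by (rule eventually_value_nonzero)
  with assms have "eventually (\<lambda>x. (\<exists>v. has_value r x v \<and> has_value s x v) \<and> \<not> has_value ?d x 0) generic"
    by (rule eventually_conj)
  then obtain x v where x: "has_value r x v" "has_value s x v" "\<not> has_value ?d x 0"
    using eventually_happens'[OF generic_neq_bot] by blast
  have "has_value ?d x (v + (-1) * v)"
    by (intro has_value.rel_add has_value.rel_mult has_value_const x)
  then show False
    using x(3) by simp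
qed

lemma eventually_zariski_open:
  assumes "zariski_open U" "U \<noteq> {}"
  shows "eventually (\<lambda>x. x \<in> U) generic"
proof -
  obtain S where S: "- U = {x. \<forall>p\<in>S. poly_eval p x = 0}"
    using assms(1) by (auto simp: zariski_open_def zariski_closed_def)
  obtain y where "y \<in> U"
    using assms(2) by blast
  then obtain p where p: "p \<in> S" "poly_eval p y \<noteq> 0"
    using S by blast
  then have "p \<noteq> 0"
    by auto
  then have "eventually (\<lambda>x. poly_eval p x \<noteq> 0) generic"
    by (rule eventually_poly_eval_nonzero)
  then show ?thesis
    by (rule eventually_mono) (use S p in blast)
qed

lemma has_value_component:
  "x \<in> ratmap_domain F \<Longrightarrow> has_value (F $ i) x (ratmap_eval F x $ i)"
  by (simp add: ratmap_domain_def has_value_def ratmap_eval_def)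

lemma has_value_peval_component:
  assumes "x \<in> ratmap_domain F"
  shows "has_value (peval ratfun_const (($) F) p) x (poly_eval p (ratmap_eval F x))"
  unfolding poly_eval_peval
  by (intro has_value.rel_peval has_value_const has_value_component assms)

text \<open>A relation among the components would confine the image of \<open>F\<close> to the zero
  set of \<open>p\<close>; density then forces \<open>p\<close> to vanish everywhere.\<close>

lemma algebraically_independent:
  assumes "dominant F" "p \<noteq> 0"
  shows "peval ratfun_const (($) F) p \<noteq> 0"
proof
  assume zero: "peval ratfun_const (($) F) p = 0"
  have "poly_eval p (ratmap_eval F x) = 0" if "x \<in> ratmap_domain F" for x
    using has_value_peval_component[OF that, of p] has_value.rel_0 has_value_unique
    unfolding zero by blast
  then have "ratmap_eval F ` ratmap_domain F \<subseteq> {y. poly_eval p y = 0}"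
    by blast
  moreover have "zariski_closed {y. poly_eval p y = 0}"
    unfolding zariski_closed_def by (intro exI[of _ "{p}"]) simp
  ultimately have "{y. poly_eval p y = 0} = UNIV"
    using assms(1) unfolding dominant_def zariski_dense_def by blast
  then show False
    using poly_eval_nonzero_exists[OF assms(2)] by blast
qed

section \<open>Substituting the components of a dominant map\<close>

text \<open>For dominant \<open>F\<close> this is the embedding of R(Y) into R(X) that sends the
  i-th variable to \<open>F $ i\<close>. \<open>SOME\<close> picks a representing fraction, and
  \<open>subst_Fract\<close> shows that the result does not depend on it.\<close>

definition ratfun_subst :: "'n::{finite,linorder} ratmap \<Rightarrow> 'n ratfun \<Rightarrow> 'n ratfun" where
  "ratfun_subst F r = (SOME s. \<exists>p q. q \<noteq> 0 \<and> r = Fract p q \<and>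
     s = peval ratfun_const (($) F) p / peval ratfun_const (($) F) q)"

locale dominant_ratmap =
  fixes F :: "'n::{finite,linorder} ratmap"
  assumes dominant: "dominant F"
begin

abbreviation \<phi> :: "'n ratfun \<Rightarrow> 'n ratfun" where
  "\<phi> \<equiv> ratfun_subst F"

lemma subst_Fract:
  assumes "q \<noteq> 0"
  shows "\<phi> (Fract p q) = peval ratfun_const (($) F) p / peval ratfun_const (($) F) q"
proof -
  let ?e = "peval ratfun_const (($) F)"
  have "\<exists>s p' q'. q' \<noteq> 0 \<and> Fract p q = Fract p' q' \<and> s = ?e p' / ?e q'"
    using assms by blast
  then have "\<exists>p' q'. q' \<noteq> 0 \<and> Fract p q = Fract p' q' \<and> \<phi> (Fract p q) = ?e p' / ?e q'"
    unfolding ratfun_subst_def by (rule someI_ex)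
  then obtain p' q' where *: "q' \<noteq> 0" "Fract p q = Fract p' q'" "\<phi> (Fract p q) = ?e p' / ?e q'"
    by blast
  have "p * q' = p' * q"
    using * assms by (simp add: eq_fract)
  then have "?e p * ?e q' = ?e p' * ?e q"
    by (metis ratfun_const.peval_mult)
  then show ?thesis
    using *(1,3) assms algebraically_independent[OF dominant] by (simp add: frac_eq_eq)
qed

lemma subst_Fract_1: "\<phi> (Fract p 1) = peval ratfun_const (($) F) p"
  by (simp add: subst_Fract ratfun_const.peval_1)

lemma subst_var: "\<phi> (ratfun_var i) = F $ i"
  by (simp add: ratfun_var_def subst_Fract_1 ratfun_const.peval_var)

lemma subst_const: "\<phi> (ratfun_const r) = ratfun_const r"
  by (simp add: subst_Fract_1 ratfun_const.peval_const ratfun_const_def[of r])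

lemma subst_0: "\<phi> 0 = 0"
  using subst_const[of 0] by (simp add: ratfun_const.hom_0)

lemma subst_1: "\<phi> 1 = 1"
  using subst_const[of 1] by (simp add: ratfun_const.hom_1)

lemma subst_add_mult: "\<phi> (r + s) = \<phi> r + \<phi> s" "\<phi> (r * s) = \<phi> r * \<phi> s"
proof -
  obtain p q p' q' where *: "r = Fract p q" "q \<noteq> 0" "s = Fract p' q'" "q' \<noteq> 0"
    by (metis Fract_cases)
  then show "\<phi> (r + s) = \<phi> r + \<phi> s" "\<phi> (r * s) = \<phi> r * \<phi> s"
    using algebraically_independent[OF dominant]
    by (simp_all add: subst_Fract ratfun_const.peval_add ratfun_const.peval_mult add_frac_eq)
qed

lemmas subst_add = subst_add_mult(1)
lemmas subst_mult = subst_add_mult(2)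

lemma subst_minus: "\<phi> (- r) = - \<phi> r"
  using subst_add[of r "- r"] by (simp add: subst_0 eq_neg_iff_add_eq_0 add.commute)

lemma subst_inverse: "\<phi> (inverse r) = inverse (\<phi> r)"
proof (cases "r = 0")
  case False
  then have "\<phi> r * \<phi> (inverse r) = 1"
    by (simp add: subst_1 flip: subst_mult)
  then show ?thesis
    by (metis inverse_unique)
qed (simp add: subst_0)

text \<open>Substitution represents composition with \<open>F\<close>, so identities over the
  codomain can be evaluated at points of a fibre.\<close>

lemma has_value_subst:
  assumes "x \<in> ratmap_domain F" "has_value r (ratmap_eval F x) v"
  shows "has_value (\<phi> r) x v"
proof -
  obtain p q where *: "r = Fract p q" "poly_eval q (ratmap_eval F x) \<noteq> 0"
    "v = poly_eval p (ratmap_eval F x) / poly_eval q (ratmap_eval F x)"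
    using assms(2) unfolding has_value_iff by blast
  have "q \<noteq> 0"
    using *(2) by auto
  show ?thesis
    unfolding *(1,3) subst_Fract[OF \<open>q \<noteq> 0\<close>]
    by (intro has_value_divide has_value_peval_component assms(1) *(2))
qed

section \<open>A separable primitive element\<close>

definition theta :: "('n \<Rightarrow> real) \<Rightarrow> 'n ratfun" where
  "theta u = (\<Sum>k\<in>UNIV. ratfun_const (u k) * ratfun_var k)"

text \<open>The parameters \<open>u k\<close> get variables of their own beside
  \<open>theta u\<close> and the components, so that a relation can be differentiated with respect
  to them.\<close>

definition gens :: "('n \<Rightarrow> real) \<Rightarrow> ('n + 'n) option \<Rightarrow> 'n ratfun" where
  "gens u j = (case j of None \<Rightarrow> theta u | Some (Inl i) \<Rightarrow> F $ i | Some (Inr k) \<Rightarrow> ratfun_const (u k))"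

lemma common_denominator:
  obtains P :: "'n \<Rightarrow> 'n rpoly" and Q where "Q \<noteq> 0" "\<And>j. Fract Q 1 * F $ j = Fract (P j) 1"
proof -
  have "\<forall>j. \<exists>p q. F $ j = Fract p q \<and> q \<noteq> 0"
    by (metis Fract_cases)
  then obtain p q where pq: "\<And>j. F $ j = Fract (p j) (q j)" "\<And>j. q j \<noteq> 0"
    by metis
  show thesis
  proof (rule that)
    show "(\<Prod>j\<in>UNIV. q j) \<noteq> 0"
      using pq(2) by simp
    show "Fract (\<Prod>j\<in>UNIV. q j) 1 * F $ j = Fract (p j * (\<Prod>i\<in>UNIV - {j}. q i)) 1" for j
      using pq(2) by (subst prod.remove[of _ j]) (auto simp: pq(1) eq_fract)
  qed
qed

text \<open>With the parameters treated as indeterminates, these are 2n + 1 rational functions in 2n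
  variables, hence dependent; the relation is then uniform in \<open>u\<close>.\<close>

lemma gens_dependent:
  obtains \<Phi> where "\<Phi> \<noteq> 0" "\<And>u. peval ratfun_const (gens u) \<Phi> = 0"
proof -
  obtain P :: "'n \<Rightarrow> 'n rpoly" and Q where PQ: "Q \<noteq> 0" "\<And>j. Fract Q 1 * F $ j = Fract (P j) 1"
    using common_denominator by blast
  define lift :: "'n rpoly \<Rightarrow> ('n + 'n) rpoly" where
    "lift = peval (\<lambda>r. Poly_Mapping.single 0 r) (\<lambda>i. pvar (Inl i))"
  define p where "p = (\<lambda>j :: ('n + 'n) option. case j of
      None \<Rightarrow> lift Q * (\<Sum>k\<in>UNIV. pvar (Inr k) * pvar (Inl k))
    | Some (Inl i) \<Rightarrow> lift (P i) | Some (Inr k) \<Rightarrow> lift Q * pvar (Inr k))"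
  \<comment> \<open>\<open>w u\<close> specialises the 2n indeterminates: the left ones become the
    variables of R(X), the right ones the real constants \<open>u k\<close>.\<close>
  define w :: "('n \<Rightarrow> real) \<Rightarrow> 'n + 'n \<Rightarrow> 'n ratfun" where
    "w = (\<lambda>u. case_sum ratfun_var (\<lambda>k. ratfun_const (u k)))"
  have w: "w u (Inl i) = ratfun_var i" "w u (Inr i) = ratfun_const (u i)" for u i
    by (simp_all add: w_def)
  have lift: "peval ratfun_const (w u) (lift r) = Fract r 1" for u r
    by (simp add: lift_def ratfun_const.peval_peval ratfun_const.peval_var w peval_ratfun_var)
  have "CARD('n + 'n) < CARD(('n + 'n) option)"
    by (simp add: card_UNIV_option)
  from algebraic_dependence[OF this, of "lift Q" p, where 'a = "'n ratfun"]
  obtain \<Phi> :: "(('n + 'n) option) rpoly" where \<Phi>: "\<Phi> \<noteq> 0"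
    "\<And>c w (g :: ('n + 'n) option \<Rightarrow> 'n ratfun). real_hom c \<Longrightarrow> peval c w (lift Q) \<noteq> 0 \<Longrightarrow>
      (\<And>j. peval c w (lift Q) * g j = peval c w (p j)) \<Longrightarrow> peval c g \<Phi> = 0"
    by blast
  show thesis
  proof (rule that[OF \<Phi>(1)])
    fix u
    show "peval ratfun_const (gens u) \<Phi> = 0"
    proof (rule \<Phi>(2)[of _ "w u"])
      show "peval ratfun_const (w u) (lift Q) * gens u j = peval ratfun_const (w u) (p j)" for j
      proof (cases j)
        case None
        then show ?thesis
          by (simp add: p_def gens_def theta_def lift ratfun_const.peval_mult ratfun_const.peval_sum
              ratfun_const.peval_var w)
      next
        case (Some i)
        then show ?thesis
          by (cases i) (simp_all add: p_def gens_def lift PQ(2) ratfun_const.peval_mult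
              ratfun_const.peval_var w)
      qed
      show "peval ratfun_const (w u) (lift Q) \<noteq> 0"
        using PQ(1) by (simp add: lift Zero_fract_def eq_fract)
    qed (rule ratfun_const.real_hom_axioms)
  qed
qed

text \<open>A relation free of \<open>theta u\<close> would relate only components and parameters.
  Fixing the parameters at suitable reals leaves a nonzero relation among the components, against
  algebraic independence.\<close>

lemma gens_dependence_involves_theta:
  assumes "q \<noteq> 0" "\<And>u. peval ratfun_const (gens u) q = 0"
  shows "pdiff None q \<noteq> 0"
proof
  assume pdiff: "pdiff None q = 0"
  have cong: "peval c v q = peval c v' q" if "\<And>j. v (Some j) = v' (Some j)"
    for c and v v' :: "('n + 'n) option \<Rightarrow> 'b::comm_ring_1"
    unfolding peval_def
  proof (intro sum.cong refl arg_cong2[where f = "(*)"] prod.cong)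
    fix m i
    assume "m \<in> Poly_Mapping.keys q"
    then show "v i ^ Poly_Mapping.lookup m i = v' i ^ Poly_Mapping.lookup m i"
      using that pdiff_eq_0D[OF pdiff] by (cases i) auto
  qed
  obtain x where x: "peval (\<lambda>r. r) x q \<noteq> 0"
    using peval_nonzero_exists[OF assms(1)] .
  \<comment> \<open>The parameters are read off from a point where \<open>q\<close> does not vanish,
    which keeps the specialised polynomial \<open>q'\<close> nonzero. The entry 0 at
    \<open>None\<close> in \<open>v\<close> is arbitrary by \<open>cong\<close>.\<close>
  define u where "u = (\<lambda>k. x (Some (Inr k)))"
  define v :: "('n + 'n) option \<Rightarrow> 'n rpoly" where "v = (\<lambda>j. case j of None \<Rightarrow> 0
    | Some (Inl i) \<Rightarrow> pvar i | Some (Inr k) \<Rightarrow> Poly_Mapping.single 0 (u k))"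
  define q' where "q' = peval (\<lambda>r. Poly_Mapping.single 0 r) v q"
  have "peval ratfun_const (($) F) q' = peval ratfun_const (\<lambda>j. peval ratfun_const (($) F) (v j)) q"
    by (simp add: q'_def ratfun_const.peval_peval)
  also have "\<dots> = peval ratfun_const (gens u) q"
    by (rule cong)
      (auto simp: v_def gens_def ratfun_const.peval_var ratfun_const.peval_const split: sum.split)
  finally have "q' = 0"
    using assms(2) algebraically_independent[OF dominant] by metis
  then have "0 = peval (\<lambda>r. r) (\<lambda>i. x (Some (Inl i))) q'"
    by (simp add: id_hom.peval_0)
  also have "\<dots> = peval (\<lambda>r. r) (\<lambda>j. peval (\<lambda>r. r) (\<lambda>i. x (Some (Inl i))) (v j)) q"
    by (simp add: q'_def id_hom.peval_peval)
  also have "\<dots> = peval (\<lambda>r. r) x q"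
    by (rule cong) (auto simp: v_def u_def id_hom.peval_var id_hom.peval_const split: sum.split)
  finally show False
    using x by simp
qed

text \<open>
  Kronecker's form of the primitive element theorem: if a relation holds for \<open>theta u\<close>
  identically in the parameters \<open>u\<close>, differentiating it with respect to the \<open>k\<close>-th parameter
  expresses the \<open>k\<close>-th variable rationally in \<open>theta u\<close>.
\<close>

lemma kronecker_relation:
  obtains u \<Phi> where "peval ratfun_const (gens u) \<Phi> = 0"
    "peval ratfun_const (gens u) (pdiff None \<Phi>) \<noteq> 0"
    "\<And>k. peval ratfun_const (gens u) (pdiff (Some (Inr k)) \<Phi>) +
      peval ratfun_const (gens u) (pdiff None \<Phi>) * ratfun_var k = 0"
proof -
  let ?P = "\<lambda>q. \<forall>u. peval ratfun_const (gens u) q = 0"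
  obtain \<Phi>0 where "?P \<Phi>0" "\<Phi>0 \<noteq> 0"
    using gens_dependent by metis
  \<comment> \<open>Otherwise \<open>?P\<close> would be stable under \<open>pdiff None\<close>, and
    descent would end at a nonzero relation not involving \<open>theta u\<close>.\<close>
  then have "\<exists>\<Phi>. ?P \<Phi> \<and> \<not> ?P (pdiff None \<Phi>)"
    using minimal_annihilated[of ?P \<Phi>0 "{None}"] gens_dependence_involves_theta by blast
  then obtain \<Phi> u where \<Phi>: "?P \<Phi>" "peval ratfun_const (gens u) (pdiff None \<Phi>) \<noteq> 0"
    by blast
  show thesis
  proof (rule that)
    show "peval ratfun_const (gens u) \<Phi> = 0" "peval ratfun_const (gens u) (pdiff None \<Phi>) \<noteq> 0"
      using \<Phi> by auto
    fix k
    \<comment> \<open>Raising the \<open>k\<close>-th parameter by \<open>r\<close> moves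
      \<open>theta u\<close> by \<open>r\<close> times the \<open>k\<close>-th variable and leaves
      the components fixed; \<open>d\<close> is the direction of this motion.\<close>
    define d where "d = (\<lambda>j :: ('n + 'n) option. if j = None then ratfun_var k
      else if j = Some (Inr k) then 1 else 0)"
    have theta: "theta (u(k := u k + r)) = theta u + ratfun_const r * ratfun_var k" for r
    proof -
      have "theta (u(k := u k + r)) =
          (\<Sum>i\<in>UNIV. ratfun_const (u i) * ratfun_var i + (if i = k then ratfun_const r * ratfun_var i else 0))"
        unfolding theta_def by (intro sum.cong) (auto simp: ratfun_const.hom_add distrib_right)
      then show ?thesis
        by (simp add: sum.distrib theta_def)
    qed
    have "(\<lambda>j. gens u j + ratfun_const r * d j) = gens (u(k := u k + r))" for r
      by (auto simp: fun_eq_iff gens_def d_def theta ratfun_const.hom_add split: option.split sum.split)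
    then have "(\<Sum>j\<in>UNIV. peval ratfun_const (gens u) (pdiff j \<Phi>) * d j) = 0"
      using \<Phi>(1) by (intro directional_derivative_vanishes) (auto simp: ratfun_const.real_hom_axioms)
    also have "(\<Sum>j\<in>UNIV. peval ratfun_const (gens u) (pdiff j \<Phi>) * d j) =
        (\<Sum>j\<in>{None, Some (Inr k)}. peval ratfun_const (gens u) (pdiff j \<Phi>) * d j)"
      by (intro sum.mono_neutral_right) (auto simp: d_def)
    finally show "peval ratfun_const (gens u) (pdiff (Some (Inr k)) \<Phi>) +
        peval ratfun_const (gens u) (pdiff None \<Phi>) * ratfun_var k = 0"
      by (simp add: d_def add.commute)
  qed
qed

end

lemma (in ring_rel) rel_of_nat: "R (of_nat n) (of_nat n)"
  by (induction n) (auto intro: rel_0 rel_1 rel_add)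

section \<open>Specialising polynomials with rational function coefficients\<close>

definition poly_value :: "'n::{finite,linorder} ratfun poly \<Rightarrow> 'n point \<Rightarrow> real poly \<Rightarrow> bool" where
  "poly_value A y a \<longleftrightarrow> (\<forall>i. has_value (coeff A i) y (coeff a i))"

lemma poly_value_unique: "poly_value A y a \<Longrightarrow> poly_value A y b \<Longrightarrow> a = b"
  unfolding poly_value_def using has_value_unique by (metis poly_eqI)

lemma poly_value_pCons: "has_value r y v \<Longrightarrow> poly_value A y a \<Longrightarrow> poly_value (pCons r A) y (pCons v a)"
  by (auto simp: poly_value_def coeff_pCons split: nat.split)

lemma poly_value_0: "poly_value 0 y 0"
  by (simp add: poly_value_def has_value.rel_0)

interpretation poly_value: ring_rel "\<lambda>A a. poly_value A y a"
proof
  show "poly_value 0 y 0"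
    by (rule poly_value_0)
  show "poly_value 1 y 1"
    using poly_value_pCons[OF has_value.rel_1 poly_value_0] by (simp add: one_pCons)
qed (auto simp: poly_value_def coeff_mult intro!: has_value.rel_add has_value.rel_sum has_value.rel_mult)

lemma poly_value_const: "has_value r y v \<Longrightarrow> poly_value [:r:] y [:v:]"
  by (rule poly_value_pCons[OF _ poly_value_0])

lemma poly_value_X: "poly_value [:0, 1:] y [:0, 1:]"
  by (intro poly_value_pCons has_value.rel_0 has_value.rel_1 poly_value_0)

lemma poly_value_pderiv: "poly_value A y a \<Longrightarrow> poly_value (pderiv A) y (pderiv a)"
  unfolding poly_value_def coeff_pderiv
  by (auto intro!: has_value.rel_mult has_value.rel_of_nat simp del: of_nat_Suc)

text \<open>The leading coefficient 1 specialises to 1, so the degree cannot drop.\<close>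

lemma poly_value_degree:
  assumes "poly_value A y a" "lead_coeff A = 1"
  shows "degree a = degree A"
proof (rule antisym)
  have "coeff a i = 0" if "i > degree A" for i
  proof -
    have "has_value 0 y (coeff a i)"
      using assms(1) coeff_eq_0[OF that] unfolding poly_value_def by metis
    then show ?thesis
      using has_value.rel_0 has_value_unique by blast
  qed
  then show "degree a \<le> degree A"
    by (intro degree_le) auto
  have "coeff a (degree A) = 1"
    using assms has_value_unique[OF _ has_value.rel_1] by (metis poly_value_def)
  then show "degree A \<le> degree a"
    by (intro le_degree) auto
qed

lemma eventually_poly_value: "eventually (\<lambda>y. \<exists>a. poly_value A y a) generic"
proof (induction A)
  case 0
  show ?case
    using poly_value_0 by (intro always_eventually) blast
next
  case (pCons r A)
  from pCons.IH eventually_defined[of r] show ?case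
  proof eventually_elim
    case (elim y)
    then obtain a where "poly_value A y a" "has_value r y (ratfun_eval r y)"
      by (auto simp: has_value_def)
    then show ?case
      using poly_value_pCons by blast
  qed
qed

section \<open>Real roots and the parity of the degree\<close>

lemma real_poly_root_if_odd_degree:
  fixes p :: "real poly"
  assumes "odd (degree p)"
  shows "\<exists>x. poly p x = 0"
proof -
  have *: "\<exists>x. poly p x = 0" if p: "odd (degree p)" "lead_coeff p > 0" for p :: "real poly"
  proof -
    obtain b where b: "\<And>x. x \<ge> b \<Longrightarrow> poly p x \<ge> lead_coeff p"
      using poly_pinfty_gt_lc[OF p(2)] by blast
    \<comment> \<open>Reflection at 0 followed by a change of sign preserves the leading coefficient
      in odd degree, so large arguments of \<open>?q\<close> give negative values of
      \<open>p\<close> far to the left.\<close>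
    let ?q = "- pcompose p [:0, -1:]"
    have "lead_coeff ?q = lead_coeff p"
      using p(1) by (simp add: lead_coeff_comp flip: coeff_minus)
        (simp add: lead_coeff_comp lead_coeff_minus)
    then obtain a where a: "\<And>x. x \<ge> a \<Longrightarrow> poly ?q x \<ge> lead_coeff p"
      using poly_pinfty_gt_lc[of ?q] p(2) by metis
    define l where "l = - max a 1"
    define r where "r = max b 1"
    have "poly p l < 0"
      using a[of "- l"] p(2) by (simp add: l_def poly_pcompose)
    moreover have "poly p r > 0"
      using b[of r] p(2) by (simp add: r_def)
    moreover have "l < r"
      by (simp add: l_def r_def)
    ultimately show ?thesis
      using poly_IVT_pos by blast
  qed
  show ?thesis
  proof (cases "lead_coeff p > 0")
    case False
    then have "lead_coeff (- p) > 0"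
      using assms by (auto simp: lead_coeff_minus not_less less_le)
    then show ?thesis
      using *[of "- p"] assms by auto
  qed (use * assms in blast)
qed

text \<open>After the linear factor is split off, simplicity gives a cofactor that is nonzero at
  \<open>t\<close>, and uniqueness excludes any other real root. Such a cofactor has even
  degree.\<close>

lemma odd_degree_if_unique_simple_root:
  fixes p :: "real poly"
  assumes "poly p t = 0" "poly (pderiv p) t \<noteq> 0" "\<And>s. poly p s = 0 \<Longrightarrow> s = t"
  shows "odd (degree p)"
proof -
  obtain h where h: "p = [:- t, 1:] * h"
    using assms(1) by (metis poly_eq_0_iff_dvd dvdE)
  have "pderiv p = [:- t, 1:] * pderiv h + h * pderiv [:- t, 1:]"
    unfolding h by (rule pderiv_mult)
  then have "poly h t \<noteq> 0"
    using assms(2) by (simp add: pderiv_pCons)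
  moreover have "s = t" if "poly h s = 0" for s
    using assms(3)[of s] that unfolding h poly_mult by simp
  ultimately have "even (degree h)"
    using real_poly_root_if_odd_degree by metis
  moreover have "h \<noteq> 0"
    using \<open>poly h t \<noteq> 0\<close> by auto
  ultimately show ?thesis
    unfolding h by (subst degree_mult_eq) auto
qed

context dominant_ratmap
begin

section \<open>The minimal polynomial\<close>

text \<open>Polynomials over the component field are represented with coefficients in R(Y), moved
  into R(X) by \<open>\<phi>\<close>. Coefficients in R(Y) can be specialised at points of the
  codomain.\<close>

definition ev :: "'n ratfun \<Rightarrow> 'n ratfun poly \<Rightarrow> 'n ratfun" where
  "ev t A = poly (map_poly \<phi> A) t"

lemma ev_0: "ev t 0 = 0"
  by (simp add: ev_def)

lemma ev_pCons: "ev t (pCons a A) = \<phi> a + t * ev t A"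
  by (simp add: ev_def map_poly_pCons subst_0)

lemma ev_const: "ev t [:a:] = \<phi> a"
  by (simp add: ev_pCons ev_0)

lemma ev_1: "ev t 1 = 1"
  by (simp add: one_pCons ev_const subst_1)

lemma ev_add: "ev t (A + B) = ev t A + ev t B"
  by (induction A B rule: poly_induct2) (simp_all add: ev_0 ev_pCons subst_add algebra_simps)

lemma ev_smult: "ev t (smult c A) = \<phi> c * ev t A"
  by (induction A) (simp_all add: ev_0 ev_pCons subst_mult algebra_simps)

lemma ev_mult: "ev t (A * B) = ev t A * ev t B"
  by (induction A) (simp_all add: ev_0 ev_pCons ev_add ev_smult subst_0 algebra_simps)

lemma ev_minus: "ev t (- A) = - ev t A"
  using ev_add[of t A "- A"] by (simp add: ev_0 eq_neg_iff_add_eq_0 add.commute)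

lemma ev_diff: "ev t (A - B) = ev t A - ev t B"
  using ev_add[of t A "- B"] by (simp add: ev_minus)

lemma ev_monom: "ev t (monom a k) = \<phi> a * t ^ k"
  by (induction k) (simp_all add: monom_0 monom_Suc ev_const ev_0 ev_pCons subst_0 algebra_simps)

lemma has_value_ev:
  assumes "x \<in> ratmap_domain F" "has_value s x t" "poly_value A (ratmap_eval F x) a"
  shows "has_value (ev s A) x (poly a t)"
  using assms(3)
proof (induction A arbitrary: a)
  case 0
  then have "a = 0"
    using poly_value_unique poly_value_0 by blast
  then show ?case
    by (simp add: ev_0 has_value.rel_0)
next
  case (pCons r A)
  obtain v b where a: "a = pCons v b"
    by (rule pCons_cases)
  have "has_value r (ratmap_eval F x) v" "poly_value A (ratmap_eval F x) b"
    using pCons.prems unfolding poly_value_def a by (metis coeff_pCons_0 coeff_pCons_Suc)+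
  then show ?case
    unfolding a ev_pCons poly_pCons
    using assms(1,2) pCons.IH by (intro has_value.rel_add has_value.rel_mult has_value_subst)
qed

text \<open>Stated as the monic generator of the kernel of \<open>ev t\<close>: this turns
  equalities in R(X) into congruences modulo \<open>M\<close>.\<close>

definition minimal_poly :: "'n ratfun \<Rightarrow> 'n ratfun poly \<Rightarrow> bool" where
  "minimal_poly t M \<longleftrightarrow> lead_coeff M = 1 \<and> (\<forall>A. ev t A = 0 \<longleftrightarrow> M dvd A)"

lemma minimal_poly_exists:
  assumes "ev t B = 0" "B \<noteq> 0"
  obtains M where "minimal_poly t M"
proof -
  have "\<exists>N. (N \<noteq> 0 \<and> ev t N = 0) \<and> (\<forall>A. A \<noteq> 0 \<and> ev t A = 0 \<longrightarrow> degree N \<le> degree A)"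
    using assms ex_has_least_nat[of "\<lambda>N. N \<noteq> 0 \<and> ev t N = 0" B degree] by blast
  then obtain N where N: "N \<noteq> 0" "ev t N = 0"
    "\<And>A. A \<noteq> 0 \<Longrightarrow> ev t A = 0 \<Longrightarrow> degree N \<le> degree A"
    by blast
  define M where "M = smult (inverse (lead_coeff N)) N"
  have M: "M \<noteq> 0" "ev t M = 0" "lead_coeff M = 1" "degree M = degree N"
    using N(1,2) by (simp_all add: M_def ev_smult)
  have "M dvd A" if "ev t A = 0" for A
  proof -
    have "ev t A = ev t (M * (A div M) + A mod M)"
      by simp
    also have "\<dots> = ev t M * ev t (A div M) + ev t (A mod M)"
      by (simp only: ev_add ev_mult)
    finally have "ev t (A mod M) = 0"
      using that M(2) by simp
    then have "A mod M = 0"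
      using N(3)[of "A mod M"] M(4) degree_mod_less'[OF M(1), of A] by linarith
    then show ?thesis
      by (simp add: dvd_eq_mod_eq_0)
  qed
  moreover have "ev t A = 0" if "M dvd A" for A
  proof -
    obtain C where "A = M * C"
      using \<open>M dvd A\<close> by (rule dvdE)
    then show ?thesis
      by (simp add: ev_mult M(2))
  qed
  ultimately have "minimal_poly t M"
    unfolding minimal_poly_def using M(3) by blast
  then show thesis
    by (rule that)
qed

text \<open>Euclid's algorithm: dividing \<open>M\<close> by \<open>A\<close> with quotient
  \<open>q\<close> and remainder \<open>r\<close> gives \<open>ev t r = - (ev t A * ev t q)\<close>,
  so an inverse for the smaller remainder yields one for \<open>A\<close>.\<close>

lemma ev_inverse:
  assumes "minimal_poly t M" "ev t A \<noteq> 0"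
  obtains B where "ev t B * ev t A = 1"
proof -
  have M0: "M \<noteq> 0"
    using assms(1) by (auto simp: minimal_poly_def)
  have dvd: "ev t C = 0 \<longleftrightarrow> M dvd C" for C
    using assms(1) by (simp add: minimal_poly_def)
  have *: "\<exists>B. ev t B * ev t A = 1" if "ev t A \<noteq> 0" "degree A < degree M" for A
    using that
  proof (induction "degree A" arbitrary: A rule: less_induct)
    case (less A)
    have A0: "A \<noteq> 0"
      using less.prems by (auto simp: ev_0)
    show ?case
    proof (cases "degree A = 0")
      case True
      then obtain a where a: "A = [:a:]"
        by (metis degree_eq_zeroE)
      then have "ev t [:inverse a:] * ev t A = 1"
        using A0 by (simp add: ev_const subst_1 flip: subst_mult)
      then show ?thesis ..
    next
      case False
      define r where "r = M mod A"
      define q where "q = M div A"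
      have M: "M = A * q + r"
        by (simp add: r_def q_def)
      have "ev t M = 0"
        by (simp add: dvd)
      moreover have "ev t M = ev t A * ev t q + ev t r"
        unfolding M ev_add ev_mult ..
      ultimately have evr: "ev t r = - (ev t A * ev t q)"
        by (simp add: add_eq_0_iff)
      \<comment> \<open>A vanishing remainder value would make \<open>M\<close> divide the nonzero
        quotient \<open>q\<close>, whose degree is smaller because \<open>A\<close> is not
        constant.\<close>
      have "ev t r \<noteq> 0"
      proof
        assume "ev t r = 0"
        then have "ev t q = 0"
          using evr less.prems(1) by simp
        then have "M dvd q"
          by (simp add: dvd)
        have "q \<noteq> 0"
        proof
          assume "q = 0"
          then have "r = M"
            using M by simp
          then show False
            using less.prems(2) degree_mod_less'[OF A0, of M] M0 by (simp add: r_def)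
        qed
        then have "degree M \<le> degree q"
          using \<open>M dvd q\<close> by (rule dvd_imp_degree_le[rotated])
        moreover have "degree A + degree q \<le> degree M"
        proof -
          have "degree r \<le> degree M"
            unfolding r_def using degree_mod_less[OF A0, of M] less.prems(2) by auto
          then have "degree (M - r) \<le> degree M"
            by (intro degree_diff_le) auto
          moreover have "M - r = A * q"
            using M by simp
          ultimately show ?thesis
            using A0 \<open>q \<noteq> 0\<close> by (simp add: degree_mult_eq)
        qed
        ultimately show False
          using False by linarith
      qed
      moreover from this have "r \<noteq> 0"
        by (auto simp: ev_0)
      then have "degree r < degree A"
        using degree_mod_less[OF A0, of M] by (simp add: r_def)
      ultimately obtain B where "ev t B * ev t r = 1"
        using less by (meson order.strict_trans)
      then have "ev t (- B * q) * ev t A = 1"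
        by (simp add: evr ev_mult ev_minus mult_ac)
      then show ?thesis ..
    qed
  qed
  show thesis
  proof (cases "degree M = 0")
    case True
    then have "M dvd A"
      using M0 by (metis degree_eq_zeroE is_unit_pCons_iff unit_imp_dvd pCons_0_0 is_unit_triv)
    then show thesis
      using assms(2) dvd by blast
  next
    case False
    have "ev t A = ev t (M * (A div M) + A mod M)"
      by simp
    also have "\<dots> = ev t M * ev t (A div M) + ev t (A mod M)"
      by (simp only: ev_add ev_mult)
    finally have "ev t (A mod M) = ev t A"
      using dvd[of M] by simp
    moreover have "degree (A mod M) < degree M"
      using degree_mod_less'[OF M0, of A] False by (cases "A mod M = 0") auto
    ultimately show thesis
      using that *[of "A mod M"] assms(2) by auto
  qed
qed

text \<open>Reads a relation among \<open>gens u\<close> as a univariate polynomial over R(Y): the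
  unknown stands for \<open>theta u\<close>, and the i-th variable of R(Y) for
  \<open>F $ i\<close>.\<close>

definition lift_poly :: "('n \<Rightarrow> real) \<Rightarrow> (('n + 'n) option) rpoly \<Rightarrow> 'n ratfun poly" where
  "lift_poly u = peval (\<lambda>r. [:ratfun_const r:])
    (\<lambda>j. case j of None \<Rightarrow> [:0, 1:] | Some (Inl i) \<Rightarrow> [:ratfun_var i:] | Some (Inr k) \<Rightarrow> [:ratfun_const (u k):])"

lemma ev_lift_poly: "ev (theta u) (lift_poly u p) = peval ratfun_const (gens u) p"
proof -
  have "ev (theta u) (lift_poly u p) = peval (\<lambda>r. ev (theta u) [:ratfun_const r:])
    (\<lambda>j. ev (theta u) (case j of None \<Rightarrow> [:0, 1:] | Some (Inl i) \<Rightarrow> [:ratfun_var i:]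
      | Some (Inr k) \<Rightarrow> [:ratfun_const (u k):])) p"
    unfolding lift_poly_def by (rule peval_hom) (simp_all add: ev_add ev_mult ev_1)
  also have "(\<lambda>j. ev (theta u) (case j of None \<Rightarrow> [:0, 1:] | Some (Inl i) \<Rightarrow> [:ratfun_var i:]
      | Some (Inr k) \<Rightarrow> [:ratfun_const (u k):])) = gens u"
    by (auto simp: fun_eq_iff gens_def ev_const ev_pCons ev_0 subst_0 subst_1 subst_var subst_const
        split: option.split sum.split)
  finally show ?thesis
    by (simp add: ev_const subst_const)
qed

lemma pderiv_lift_poly: "pderiv (lift_poly u p) = lift_poly u (pdiff None p)"
proof -
  let ?v = "\<lambda>j. case j of None \<Rightarrow> [:0, 1:] | Some (Inl i) \<Rightarrow> [:ratfun_var i:]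
      | Some (Inr k) \<Rightarrow> [:ratfun_const (u k):]"
  have "pderiv (lift_poly u p) = (\<Sum>j\<in>UNIV. lift_poly u (pdiff j p) * pderiv (?v j))"
    unfolding lift_poly_def
    by (rule pderiv_peval) (simp_all add: real_hom_const_poly ratfun_const.real_hom_axioms pderiv_pCons)
  also have "\<dots> = (\<Sum>j\<in>{None}. lift_poly u (pdiff j p) * pderiv (?v j))"
    by (rule sum.mono_neutral_right) (auto simp: pderiv_pCons split: option.split sum.split)
  finally show ?thesis
    by (simp add: pderiv_pCons)
qed

text \<open>The minimal polynomial \<open>M\<close> divides the lifted Kronecker relation
  \<open>B\<close>, and at \<open>theta u\<close> the derivative of \<open>B\<close> is a multiple
  of that of \<open>M\<close>; this gives separability. Dividing Kronecker's identities by the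
  derivative of \<open>B\<close> expresses each variable in \<open>theta u\<close>.\<close>

lemma primitive_element:
  obtains u M G where "minimal_poly (theta u) M" "ev (theta u) (pderiv M) \<noteq> 0"
    "\<And>k. ev (theta u) (G k) = ratfun_var k"
proof -
  obtain u \<Phi> where \<Phi>: "peval ratfun_const (gens u) \<Phi> = 0"
    "peval ratfun_const (gens u) (pdiff None \<Phi>) \<noteq> 0"
    "\<And>k. peval ratfun_const (gens u) (pdiff (Some (Inr k)) \<Phi>) +
      peval ratfun_const (gens u) (pdiff None \<Phi>) * ratfun_var k = 0"
    using kronecker_relation by blast
  define B where "B = lift_poly u \<Phi>"
  have B: "ev (theta u) B = 0" "ev (theta u) (pderiv B) \<noteq> 0"
    using \<Phi>(1,2) by (simp_all add: B_def pderiv_lift_poly ev_lift_poly)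
  then have "B \<noteq> 0"
    by (auto simp: ev_0)
  with B(1) obtain M where M: "minimal_poly (theta u) M"
    by (rule minimal_poly_exists)
  then have evM: "ev (theta u) M = 0"
    by (simp add: minimal_poly_def)
  obtain C where C: "B = M * C"
    using M B(1) unfolding minimal_poly_def by (metis dvdE)
  have "ev (theta u) (pderiv B) = ev (theta u) C * ev (theta u) (pderiv M)"
    unfolding C pderiv_mult by (simp add: ev_add ev_mult evM)
  then have "ev (theta u) (pderiv M) \<noteq> 0"
    using B(2) by auto
  moreover obtain D where D: "ev (theta u) D * ev (theta u) (pderiv B) = 1"
    using ev_inverse[OF M B(2)] .
  have "ev (theta u) (- D * lift_poly u (pdiff (Some (Inr k)) \<Phi>)) = ratfun_var k" for k
  proof -
    have *: "peval ratfun_const (gens u) (pdiff (Some (Inr k)) \<Phi>) =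
        - (ev (theta u) (pderiv B) * ratfun_var k)"
      using \<Phi>(3)[of k] by (simp add: B_def pderiv_lift_poly ev_lift_poly eq_neg_iff_add_eq_0)
    have "ev (theta u) (- D * lift_poly u (pdiff (Some (Inr k)) \<Phi>)) =
        (ev (theta u) D * ev (theta u) (pderiv B)) * ratfun_var k"
      by (simp add: ev_mult ev_minus ev_lift_poly *)
    then show ?thesis
      by (simp add: D)
  qed
  ultimately show thesis
    using that[OF M, of "\<lambda>k. - D * lift_poly u (pdiff (Some (Inr k)) \<Phi>)"] by simp
qed

text \<open>The image contains every polynomial in the variables, by substituting the
  \<open>G k\<close>, and is closed under inverses by \<open>ev_inverse\<close>.\<close>

lemma ev_surj:
  assumes "minimal_poly t M" "\<And>k. ev t (G k) = ratfun_var k"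
  shows "\<exists>A. ev t A = r"
proof -
  have poly: "ev t (peval (\<lambda>r. [:ratfun_const r:]) G p) = Fract p 1" for p
    by (subst peval_hom[where h = "ev t"])
      (simp_all add: ev_add ev_mult ev_1 ev_const subst_const assms(2) peval_ratfun_var)
  obtain p q where r: "r = Fract p q" "q \<noteq> 0"
    by (metis Fract_cases)
  have "ev t (peval (\<lambda>r. [:ratfun_const r:]) G q) \<noteq> 0"
    using r(2) by (simp add: poly Zero_fract_def eq_fract)
  then obtain B where "ev t B * ev t (peval (\<lambda>r. [:ratfun_const r:]) G q) = 1"
    by (rule ev_inverse[OF assms(1)])
  then have "ev t B = inverse (Fract q 1)"
    by (metis poly inverse_unique mult.commute)
  then have "ev t (peval (\<lambda>r. [:ratfun_const r:]) G p * B) = r"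
    using r by (simp add: ev_mult poly)
  then show ?thesis ..
qed

section \<open>The field generated by the components, and the degree\<close>

lemma
  shows component_field_1: "1 \<in> component_field F"
    and component_field_const: "ratfun_const r \<in> component_field F"
    and component_field_component: "F $ i \<in> component_field F"
    and component_field_add: "a \<in> component_field F \<Longrightarrow> b \<in> component_field F \<Longrightarrow> a + b \<in> component_field F"
    and component_field_mult: "a \<in> component_field F \<Longrightarrow> b \<in> component_field F \<Longrightarrow> a * b \<in> component_field F"
proof -
  note intros = generate_field.intros[where R = ratfun_field and H = "range ratfun_const \<union> range (($) F)",
      folded component_field_def]
  show "1 \<in> component_field F"
    using intros(1) by (simp add: ring_of_type_algebra_def)
  show "ratfun_const r \<in> component_field F" "F $ i \<in> component_field F"
    using intros(2) by auto
  show "a \<in> component_field F \<Longrightarrow> b \<in> component_field F \<Longrightarrow> a + b \<in> component_field F"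
    using intros(5)[of a b] by (simp add: ring_of_type_algebra_def)
  show "a \<in> component_field F \<Longrightarrow> b \<in> component_field F \<Longrightarrow> a * b \<in> component_field F"
    using intros(6)[of a b] by (simp add: ring_of_type_algebra_def)
qed

end

lemma ratfun_line_extension:
  fixes K E :: "'n::{finite,linorder} ratfun set"
  shows "ring.line_extension ratfun_field K a E = {k * a + e | k e. k \<in> K \<and> e \<in> E}"
  unfolding ring.line_extension_def[OF ring_from_type_algebra] set_add_def' r_coset_def
  by (auto simp: ring_of_type_algebra_def)

lemma ratfun_field_inv:
  fixes h :: "'n::{finite,linorder} ratfun"
  shows "h \<noteq> 0 \<Longrightarrow> inv\<^bsub>ratfun_field\<^esub> h = inverse h"
    and "\<ominus>\<^bsub>ratfun_field\<^esub> h = - h"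
proof -
  interpret L: field "ratfun_field :: 'n ratfun ring"
    by (rule field_from_type_algebra)
  show "inv\<^bsub>ratfun_field\<^esub> h = inverse h" if "h \<noteq> 0"
    using that by (intro L.comm_inv_char) (simp_all add: ring_of_type_algebra_def)
  show "\<ominus>\<^bsub>ratfun_field\<^esub> h = - h"
    by (intro L.minus_equality) (simp_all add: ring_of_type_algebra_def)
qed

context dominant_ratmap
begin

text \<open>Identifies the component field with the copy of R(Y) in R(X), so that \<open>ev\<close>
  really ranges over polynomials with coefficients in that field.\<close>

lemma component_field_eq: "component_field F = range \<phi>"
proof (intro equalityI subsetI)
  fix r
  assume "r \<in> component_field F"
  then have "r \<in> generate_field ratfun_field (range ratfun_const \<union> range (($) F))"
    by (simp add: component_field_def)
  then show "r \<in> range \<phi>"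
  proof (induction rule: generate_field.induct)
    case one
    have "\<one>\<^bsub>ratfun_field\<^esub> = \<phi> 1"
      by (simp add: subst_1 ring_of_type_algebra_def)
    then show ?case
      by simp
  next
    case (incl h)
    then consider c where "h = ratfun_const c" | i where "h = F $ i"
      by auto
    then show ?case
      by cases (use subst_const subst_var in \<open>metis rangeI\<close>)+
  next
    case (a_inv h)
    from a_inv.IH obtain s where "h = \<phi> s"
      by (rule rangeE)
    then have "\<ominus>\<^bsub>ratfun_field\<^esub> h = \<phi> (- s)"
      by (simp add: subst_minus ratfun_field_inv)
    then show ?case
      by simp
  next
    case (m_inv h)
    from m_inv.IH obtain s where "h = \<phi> s"
      by (rule rangeE)
    moreover have "h \<noteq> 0"
      using m_inv(2) by (simp add: ring_of_type_algebra_def)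
    ultimately have "inv\<^bsub>ratfun_field\<^esub> h = \<phi> (inverse s)"
      by (simp add: subst_inverse ratfun_field_inv)
    then show ?case
      by simp
  next
    case (eng_add h1 h2)
    from eng_add.IH obtain s1 s2 where "h1 = \<phi> s1" "h2 = \<phi> s2"
      by (elim rangeE)
    then have "h1 \<oplus>\<^bsub>ratfun_field\<^esub> h2 = \<phi> (s1 + s2)"
      by (simp add: subst_add ring_of_type_algebra_def)
    then show ?case
      by simp
  next
    case (eng_mult h1 h2)
    from eng_mult.IH obtain s1 s2 where "h1 = \<phi> s1" "h2 = \<phi> s2"
      by (elim rangeE)
    then have "h1 \<otimes>\<^bsub>ratfun_field\<^esub> h2 = \<phi> (s1 * s2)"
      by (simp add: subst_mult ring_of_type_algebra_def)
    then show ?case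
      by simp
  qed
next
  fix s
  assume "s \<in> range \<phi>"
  then obtain r where s: "s = \<phi> r"
    by blast
  obtain p q where r: "r = Fract p q" "q \<noteq> 0"
    by (metis Fract_cases)
  \<comment> \<open>The second component is a dummy; it lets \<open>rel_peval\<close> provide
    closure of the field under \<open>peval\<close>.\<close>
  interpret K: ring_rel "\<lambda>a b. a \<in> component_field F \<and> (b::real) = b"
    using component_field_const[of 0]
    by unfold_locales
      (auto simp: ratfun_const.hom_0 intro: component_field_1 component_field_add component_field_mult)
  have K: "peval ratfun_const (($) F) p \<in> component_field F" for p
    using K.rel_peval[of ratfun_const "\<lambda>r. r" "($) F" "\<lambda>_. 0" p]
    by (simp add: component_field_const component_field_component)
  have q: "peval ratfun_const (($) F) q \<noteq> 0"
    by (rule algebraically_independent[OF dominant r(2)])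
  moreover have "\<zero>\<^bsub>ratfun_field\<^esub> = (0 :: 'n ratfun)"
    by (simp add: ring_of_type_algebra_def)
  ultimately have "inv\<^bsub>ratfun_field\<^esub> (peval ratfun_const (($) F) q) \<in> component_field F"
    using K[of q] unfolding component_field_def by (intro generate_field.m_inv) simp_all
  then have "inverse (peval ratfun_const (($) F) q) \<in> component_field F"
    by (simp add: ratfun_field_inv q)
  then show "s \<in> component_field F"
    unfolding s r(1) subst_Fract[OF r(2)] divide_inverse by (intro component_field_mult K)
qed

text \<open>The spans of 1, t, ..., t^(k-1) grow by one dimension at each step while
  \<open>k\<close> is below the degree of \<open>M\<close>; division by \<open>M\<close> shows that
  the last one is everything.\<close>

lemma extension_degree:
  assumes M: "minimal_poly t M" and surj: "\<And>r. \<exists>A. ev t A = r"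
  shows "has_extension_degree ratfun_field (component_field F) (degree M)"
proof -
  interpret L: field "ratfun_field :: 'n ratfun ring"
    by (rule field_from_type_algebra)
  \<comment> \<open>Bounding by vanishing coefficients instead of by the degree makes
    \<open>E 0\<close> the zero space.\<close>
  define E where "E = (\<lambda>k. {ev t A | A. \<forall>i\<ge>k. coeff A i = 0})"
  have dvd: "ev t A = 0 \<longleftrightarrow> M dvd A" for A
    using M by (simp add: minimal_poly_def)
  have M0: "M \<noteq> 0"
    using M by (auto simp: minimal_poly_def)
  have "L.dimension k (component_field F) (E k)" if "k \<le> degree M" for k
    using that
  proof (induction k)
    case 0
    have "A = 0" if "\<forall>i\<ge>0. coeff A i = 0" for A :: "'n ratfun poly"
      using that by (simp add: poly_eq_iff)
    then have "E 0 = {ev t 0}"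
      unfolding E_def by (auto intro: exI[of _ 0])
    then show ?case
      using L.zero_dim by (simp add: ev_0 ring_of_type_algebra_def)
  next
    case (Suc k)
    \<comment> \<open>Membership would give a nonzero polynomial in the kernel of degree at most
      \<open>k\<close>, below the degree of \<open>M\<close>.\<close>
    have "t ^ k \<notin> E k"
    proof
      assume "t ^ k \<in> E k"
      then obtain A where A: "t ^ k = ev t A" "\<forall>i\<ge>k. coeff A i = 0"
        by (auto simp: E_def)
      define N where "N = monom 1 k - A"
      have "ev t N = 0"
        by (simp add: N_def ev_diff ev_monom subst_1 A(1))
      then have "M dvd N"
        by (simp add: dvd)
      moreover have "coeff N k = 1"
        using A(2) by (simp add: N_def)
      then have "N \<noteq> 0"
        by auto
      ultimately have "degree M \<le> degree N"
        by (rule dvd_imp_degree_le)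
      moreover have "degree N \<le> k"
        using A(2) by (intro degree_le) (simp add: N_def)
      ultimately show False
        using Suc.prems by simp
    qed
    moreover have "L.line_extension (component_field F) (t ^ k) (E k) = E (Suc k)"
    proof (intro equalityI subsetI)
      fix x
      assume "x \<in> L.line_extension (component_field F) (t ^ k) (E k)"
      then obtain a A where x: "x = \<phi> a * t ^ k + ev t A" "\<forall>i\<ge>k. coeff A i = 0"
        by (auto simp: ratfun_line_extension component_field_eq E_def)
      have "x = ev t (monom a k + A)"
        by (simp add: x(1) ev_add ev_monom)
      moreover have "\<forall>i\<ge>Suc k. coeff (monom a k + A) i = 0"
        using x(2) by simp
      ultimately show "x \<in> E (Suc k)"
        unfolding E_def by blast
    next
      fix x
      assume "x \<in> E (Suc k)"
      then obtain A where A: "x = ev t A" "\<forall>i\<ge>Suc k. coeff A i = 0"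
        by (auto simp: E_def)
      define B where "B = A - monom (coeff A k) k"
      have "x = \<phi> (coeff A k) * t ^ k + ev t B"
        by (simp add: A(1) B_def ev_diff ev_monom)
      moreover have "\<forall>i\<ge>k. coeff B i = 0"
        using A(2) by (auto simp: B_def)
      ultimately show "x \<in> L.line_extension (component_field F) (t ^ k) (E k)"
        unfolding ratfun_line_extension component_field_eq E_def by blast
    qed
    ultimately show ?case
      using L.Suc_dim[of "t ^ k" "E k" k "component_field F"] Suc
      by (simp add: ring_of_type_algebra_def)
  qed
  moreover have "E (degree M) = UNIV"
  proof -
    have "r \<in> E (degree M)" for r
    proof -
      obtain A where A: "ev t A = r"
        using surj by blast
      have "ev t A = ev t (M * (A div M) + A mod M)"
        by simp
      also have "\<dots> = ev t M * ev t (A div M) + ev t (A mod M)"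
        by (simp only: ev_add ev_mult)
      finally have "r = ev t (A mod M)"
        using A dvd[of M] by simp
      moreover have "coeff (A mod M) i = 0" if "i \<ge> degree M" for i
        using degree_mod_less[OF M0, of A] that by (auto intro: coeff_eq_0)
      ultimately show ?thesis
        unfolding E_def by blast
    qed
    then show ?thesis
      by blast
  qed
  ultimately have "L.dimension (degree M) (component_field F) UNIV"
    by (metis order_refl)
  then show ?thesis
    by (simp add: has_extension_degree_def ring_of_type_algebra_def)
qed

end

section \<open>Geometric degree one\<close>

lemma has_geometric_degree_1D:
  assumes "has_geometric_degree F 1"
  obtains U where "zariski_open U" "U \<noteq> {}"
    "\<And>y. y \<in> U \<Longrightarrow> \<exists>!x. x \<in> ratmap_domain F \<and> ratmap_eval F x = y"
proof -
  obtain U where U: "zariski_open U" "U \<noteq> {}"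
    "\<And>y. y \<in> U \<Longrightarrow> card {x \<in> ratmap_domain F. ratmap_eval F x = y} = 1"
    using assms unfolding has_geometric_degree_def by blast
  have "\<exists>!x. x \<in> ratmap_domain F \<and> ratmap_eval F x = y" if y: "y \<in> U" for y
  proof -
    obtain x where "{x \<in> ratmap_domain F. ratmap_eval F x = y} = {x}"
      using U(3)[OF y] by (auto simp: card_1_singleton_iff)
    then show ?thesis
      by (intro ex1I[of _ x]) auto
  qed
  then show thesis
    using that U(1,2) by blast
qed

text \<open>Polynomial identities deliver the fibre equations in cross-multiplied form; nonzero
  denominators turn them into definedness and values.\<close>

lemma ratmap_fibre_pointI:
  fixes F :: "'n::{finite,linorder} ratmap" and y :: "'n point"
  assumes "\<And>j. F $ j = Fract (P j) (Q j)" "\<And>j. poly_eval (Q j) x \<noteq> 0"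
    and "\<And>j. poly_eval (Q j) x * y $ j = poly_eval (P j) x"
  shows "x \<in> ratmap_domain F" "ratmap_eval F x = y"
proof -
  have *: "has_value (F $ j) x (y $ j)" for j
    using has_value_Fract[OF assms(2), of "P j" j] assms(2)[of j]
    by (simp add: assms(1)[of j] flip: assms(3))
  then show "x \<in> ratmap_domain F" "ratmap_eval F x = y"
    by (auto simp: ratmap_domain_def ratmap_eval_def has_value_def vec_eq_iff)
qed

context dominant_ratmap
begin

text \<open>
  Over a generic point \<open>y\<close>, the real roots of the specialised minimal polynomial correspond to
  the points of the fibre, and they are simple.
\<close>

lemma odd_degree_minimal_poly:
  assumes M: "minimal_poly (theta u) M" and sep: "ev (theta u) (pderiv M) \<noteq> 0"
    and G: "\<And>k. ev (theta u) (G k) = ratfun_var k"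
    and deg: "has_geometric_degree F 1"
  shows "odd (degree M)"
proof -
  \<comment> \<open>\<open>?S p\<close> expresses the polynomial \<open>p\<close> in the variables
    as a polynomial in \<open>theta u\<close>.\<close>
  let ?S = "peval (\<lambda>r. [:ratfun_const r:]) G"
  have dvd: "ev (theta u) A = 0 \<longleftrightarrow> M dvd A" for A
    using M by (simp add: minimal_poly_def)
  \<comment> \<open>An equality at \<open>theta u\<close> becomes a polynomial identity over R(Y)
    with an explicit cofactor, and such an identity survives specialisation at
    \<open>y\<close>.\<close>
  have congr: "\<exists>C. A = B + M * C" if eq: "ev (theta u) A = ev (theta u) B" for A B
  proof -
    have "M dvd A - B"
      using eq by (simp add: ev_diff flip: dvd)
    then obtain C where "A - B = M * C"
      by (rule dvdE)
    then show ?thesis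
      by (metis add.commute diff_add_cancel)
  qed
  have evS: "ev (theta u) (?S p) = Fract p 1" for p
    by (subst peval_hom[where h = "ev (theta u)"])
      (simp_all add: ev_add ev_mult ev_1 ev_const subst_const G peval_ratfun_var)
  have "\<forall>j. \<exists>p q. F $ j = Fract p q \<and> q \<noteq> 0"
    by (metis Fract_cases)
  then obtain P Q where PQ: "\<And>j. F $ j = Fract (P j) (Q j)" "\<And>j. Q j \<noteq> 0"
    by metis
  have "\<exists>C. ?S (Q j) * [:ratfun_var j:] = ?S (P j) + M * C" for j
    using PQ(2)[of j] by (intro congr) (simp add: ev_smult evS subst_var PQ(1) eq_fract)
  then obtain C1 where C1: "\<And>j. ?S (Q j) * [:ratfun_var j:] = ?S (P j) + M * C1 j"
    by metis
  \<comment> \<open>Invertibility modulo \<open>M\<close> keeps the denominators of \<open>F\<close>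
    nonzero at points built from roots.\<close>
  have "\<exists>W C. W * ?S (Q j) = 1 + M * C" for j
  proof -
    have "ev (theta u) (?S (Q j)) \<noteq> 0"
      using PQ(2) by (simp add: evS Zero_fract_def eq_fract)
    then obtain W where "ev (theta u) W * ev (theta u) (?S (Q j)) = 1"
      by (rule ev_inverse[OF M])
    then show ?thesis
      by (intro exI[of _ W] congr) (simp add: ev_mult ev_1)
  qed
  then obtain W C2 where C2: "\<And>j. W j * ?S (Q j) = 1 + M * C2 j"
    by metis
  \<comment> \<open>Invertibility of the derivative modulo \<open>M\<close> will make the
    specialised roots simple.\<close>
  obtain V where "ev (theta u) V * ev (theta u) (pderiv M) = 1"
    using sep by (rule ev_inverse[OF M])
  then obtain C3 where C3: "V * pderiv M = 1 + M * C3"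
    using congr[of "V * pderiv M" 1] by (auto simp: ev_mult ev_1)
  have "ev (theta u) (\<Sum>k\<in>A. [:ratfun_const (u k):] * G k) = (\<Sum>k\<in>A. ratfun_const (u k) * ratfun_var k)" for A
    by (induction A rule: infinite_finite_induct) (simp_all add: ev_0 ev_add ev_mult ev_const subst_const G
        del: mult_pCons_left)
  then have "ev (theta u) (\<Sum>k\<in>UNIV. [:ratfun_const (u k):] * G k) = ev (theta u) [:0, 1:]"
    by (simp add: theta_def ev_pCons ev_0 subst_0 subst_1)
  \<comment> \<open>This identity recovers a root from the point built from it, so distinct roots
    give distinct points.\<close>
  then obtain C4 where C4: "(\<Sum>k\<in>UNIV. [:ratfun_const (u k):] * G k) = [:0, 1:] + M * C4"
    using congr by blast
  obtain U where U: "zariski_open U" "U \<noteq> {}"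
    "\<And>y. y \<in> U \<Longrightarrow> \<exists>!x. x \<in> ratmap_domain F \<and> ratmap_eval F x = y"
    using has_geometric_degree_1D[OF deg] by blast
  \<comment> \<open>Only finitely many polynomials over R(Y) occur, so one point \<open>y\<close>
    specialises all of them and also lies in \<open>U\<close>.\<close>
  have "eventually (\<lambda>y. y \<in> U \<and> (\<exists>a. poly_value M y a) \<and> (\<forall>k. \<exists>a. poly_value (G k) y a) \<and>
      (\<forall>j. \<exists>a. poly_value (C1 j) y a) \<and> (\<forall>j. \<exists>a. poly_value (W j) y a) \<and>
      (\<forall>j. \<exists>a. poly_value (C2 j) y a) \<and> (\<exists>a. poly_value V y a) \<and>
      (\<exists>a. poly_value C3 y a) \<and> (\<exists>a. poly_value C4 y a)) generic"
    by (intro eventually_conj eventually_all_finite eventually_poly_value eventually_zariski_open U(1,2))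
  from eventually_happens'[OF generic_neq_bot this]
  obtain y m v c3 c4 where y: "y \<in> U" "\<forall>k. \<exists>a. poly_value (G k) y a"
      "\<forall>j. \<exists>a. poly_value (C1 j) y a" "\<forall>j. \<exists>a. poly_value (W j) y a"
      "\<forall>j. \<exists>a. poly_value (C2 j) y a"
    and m: "poly_value M y m" and v: "poly_value V y v"
    and c3: "poly_value C3 y c3" and c4: "poly_value C4 y c4"
    by (elim exE conjE)
  obtain g where g: "\<And>k. poly_value (G k) y (g k)"
    using y(2) by metis
  obtain c1 where c1: "\<And>k. poly_value (C1 k) y (c1 k)"
    using y(3) by metis
  obtain w where w: "\<And>k. poly_value (W k) y (w k)"
    using y(4) by metis
  obtain c2 where c2: "\<And>k. poly_value (C2 k) y (c2 k)"
    using y(5) by metis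
  let ?s = "peval (\<lambda>r. [:r:]) g"
  have s: "poly_value (?S p) y (?s p)" for p
    by (intro poly_value.rel_peval poly_value_const has_value_const g)
  have "?s (Q j) * [:y $ j:] = ?s (P j) + m * c1 j" for j
  proof (rule poly_value_unique)
    show "poly_value (?S (Q j) * [:ratfun_var j:]) y (?s (Q j) * [:y $ j:])"
      by (intro poly_value.rel_mult s poly_value_const has_value_var)
    show "poly_value (?S (Q j) * [:ratfun_var j:]) y (?s (P j) + m * c1 j)"
      unfolding C1 by (intro poly_value.rel_add poly_value.rel_mult s m c1)
  qed
  then have e1: "poly (?s (Q j)) t * y $ j = poly (?s (P j)) t + poly m t * poly (c1 j) t" for j t
    by (metis poly_add poly_mult poly_const_conv)
  have "w j * ?s (Q j) = 1 + m * c2 j" for j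
  proof (rule poly_value_unique)
    show "poly_value (W j * ?S (Q j)) y (w j * ?s (Q j))"
      by (intro poly_value.rel_mult s w)
    show "poly_value (W j * ?S (Q j)) y (1 + m * c2 j)"
      unfolding C2 by (intro poly_value.rel_add poly_value.rel_mult poly_value.rel_1 m c2)
  qed
  then have e2: "poly (w j) t * poly (?s (Q j)) t = 1 + poly m t * poly (c2 j) t" for j t
    by (metis poly_add poly_mult poly_1)
  have "v * pderiv m = 1 + m * c3"
  proof (rule poly_value_unique)
    show "poly_value (V * pderiv M) y (v * pderiv m)"
      by (intro poly_value.rel_mult poly_value_pderiv m v)
    show "poly_value (V * pderiv M) y (1 + m * c3)"
      unfolding C3 by (intro poly_value.rel_add poly_value.rel_mult poly_value.rel_1 m c3)
  qed
  then have e3: "poly v t * poly (pderiv m) t = 1 + poly m t * poly c3 t" for t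
    by (metis poly_add poly_mult poly_1)
  have "(\<Sum>k\<in>UNIV. [:u k:] * g k) = [:0, 1:] + m * c4"
  proof (rule poly_value_unique)
    show "poly_value (\<Sum>k\<in>UNIV. [:ratfun_const (u k):] * G k) y (\<Sum>k\<in>UNIV. [:u k:] * g k)"
      by (intro poly_value.rel_sum poly_value.rel_mult poly_value_const has_value_const g)
    show "poly_value (\<Sum>k\<in>UNIV. [:ratfun_const (u k):] * G k) y ([:0, 1:] + m * c4)"
      unfolding C4 by (intro poly_value.rel_add poly_value.rel_mult poly_value_X m c4)
  qed
  then have "poly (\<Sum>k\<in>UNIV. [:u k:] * g k) t = poly ([:0, 1:] + m * c4) t" for t
    by simp
  then have e4: "(\<Sum>k\<in>UNIV. u k * poly (g k) t) = t + poly m t * poly c4 t" for t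
    by (simp add: poly_sum)
  have root: "(\<Sum>k\<in>UNIV. u k * x $ k) = t"
    if t: "poly m t = 0" and x: "x = (\<chi> k. poly (g k) t)" for x t
    using e4[of t] by (simp add: t x)
  \<comment> \<open>From roots to points: the \<open>g k\<close> evaluated at a root are the
    coordinates of a point over \<open>y\<close>.\<close>
  have fibre: "(\<chi> k. poly (g k) t) \<in> ratmap_domain F \<and> ratmap_eval F (\<chi> k. poly (g k) t) = y"
    if t: "poly m t = 0" for t
  proof -
    have eval: "poly (?s p) t = poly_eval p (\<chi> k. poly (g k) t)" for p
      by (subst peval_hom[where h = "\<lambda>p. poly p t"]) (simp_all add: poly_eval_peval)
    have "poly_eval (Q j) (\<chi> k. poly (g k) t) \<noteq> 0" for j
      using e2[of j t] by (auto simp: eval t)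
    moreover have "poly_eval (Q j) (\<chi> k. poly (g k) t) * y $ j = poly_eval (P j) (\<chi> k. poly (g k) t)" for j
      using e1[of j t] by (simp add: eval t)
    ultimately show ?thesis
      using ratmap_fibre_pointI[of F P Q, OF PQ(1)] by blast
  qed
  obtain z where z: "z \<in> ratmap_domain F" "ratmap_eval F z = y"
    and z_unique: "\<And>x. x \<in> ratmap_domain F \<Longrightarrow> ratmap_eval F x = y \<Longrightarrow> x = z"
    using U(3)[OF y(1)] by metis
  \<comment> \<open>From points to roots: the value of \<open>theta u\<close> at the fibre point is
    a root of \<open>m\<close>.\<close>
  define t where "t = (\<Sum>k\<in>UNIV. u k * z $ k)"
  have "has_value (theta u) z t"
    unfolding theta_def t_def
    by (intro has_value.rel_sum has_value.rel_mult has_value_const has_value_var)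
  then have "has_value (ev (theta u) M) z (poly m t)"
    using z m by (intro has_value_ev) auto
  moreover have "ev (theta u) M = 0"
    by (simp add: dvd)
  ultimately have "poly m t = 0"
    using has_value.rel_0 has_value_unique by metis
  moreover have "poly (pderiv m) t \<noteq> 0"
    using e3[of t] \<open>poly m t = 0\<close> by auto
  moreover have "s = t" if s: "poly m s = 0" for s
  proof -
    have "(\<chi> k. poly (g k) s) = z"
      using fibre[OF s] z_unique by blast
    then show ?thesis
      using root[OF s] by (simp add: t_def)
  qed
  ultimately have "odd (degree m)"
    by (rule odd_degree_if_unique_simple_root)
  then show ?thesis
    using poly_value_degree[OF m] M by (simp add: minimal_poly_def)
qed

text \<open>
  An automorphism over the component field is a rational map whose composite with the given map
  is the given map, so generic injectivity makes it the identity.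
\<close>

lemma automorphism_trivial:
  assumes \<sigma>: "\<sigma> \<in> field_automorphisms_over ratfun_field (component_field F)"
    and deg: "has_geometric_degree F 1"
  shows "\<sigma> = id"
proof -
  have "\<sigma> \<in> ring_hom ratfun_field ratfun_field" and fixed: "\<And>r. r \<in> component_field F \<Longrightarrow> \<sigma> r = r"
    using \<sigma> by (auto simp: field_automorphisms_over_def ring_iso_def)
  then have hom: "\<sigma> (a + b) = \<sigma> a + \<sigma> b" "\<sigma> (a * b) = \<sigma> a * \<sigma> b" "\<sigma> 1 = 1" for a b
    by (auto simp: ring_hom_def ring_of_type_algebra_def)
  have peval: "\<sigma> (Fract p 1) = peval ratfun_const (\<lambda>i. \<sigma> (ratfun_var i)) p" for p
    unfolding peval_ratfun_var[symmetric]
    by (subst peval_hom[where h = \<sigma>]) (simp_all add: hom fixed component_field_const)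
  have nonzero: "\<sigma> r \<noteq> 0" if "r \<noteq> 0" for r
  proof
    assume "\<sigma> r = 0"
    then have "\<sigma> (r * inverse r) = 0"
      unfolding hom by simp
    then show False
      using that hom(3) by simp
  qed
  have "\<forall>j. \<exists>p q. F $ j = Fract p q \<and> q \<noteq> 0"
    by (metis Fract_cases)
  then obtain P Q where PQ: "\<And>j. F $ j = Fract (P j) (Q j)" "\<And>j. Q j \<noteq> 0"
    by metis
  obtain U where U: "zariski_open U" "U \<noteq> {}"
    "\<And>y. y \<in> U \<Longrightarrow> \<exists>!x. x \<in> ratmap_domain F \<and> ratmap_eval F x = y"
    using has_geometric_degree_1D[OF deg] by blast
  let ?T = "peval ratfun_const (\<lambda>i. \<sigma> (ratfun_var i))"
  have TQ: "?T (Q j) \<noteq> 0" for j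
    using nonzero[of "Fract (Q j) 1"] PQ(2)[of j] by (simp add: peval Zero_fract_def eq_fract)
  \<comment> \<open>Because \<open>\<sigma>\<close> fixes the components, applying it to the
    equation for \<open>F $ j\<close> changes only numerator and denominator; this says that
    \<open>F\<close> composed with the map of \<open>\<sigma>\<close> is \<open>F\<close>.\<close>
  have TPQ: "?T (Q j) * F $ j = ?T (P j)" for j
  proof -
    have "Fract (Q j) 1 * F $ j = Fract (P j) 1"
      using PQ(2)[of j] by (simp add: PQ(1) eq_fract)
    then have "\<sigma> (Fract (Q j) 1) * \<sigma> (F $ j) = \<sigma> (Fract (P j) 1)"
      by (metis hom(2))
    then show ?thesis
      by (simp add: peval fixed component_field_component)
  qed
  \<comment> \<open>By algebraic independence \<open>q\<close> stays nonzero after substituting the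
    components, so \<open>F\<close> sends a generic point into \<open>U\<close>.\<close>
  obtain q where q: "q \<noteq> 0" "\<And>y. poly_eval q y \<noteq> 0 \<Longrightarrow> y \<in> U"
    using eventually_zariski_open[OF U(1,2)] unfolding eventually_generic by blast
  have "eventually (\<lambda>x. \<forall>i. has_value (\<sigma> (ratfun_var i)) x (x $ i)) generic"
  proof -
    have "eventually (\<lambda>x. x \<in> ratmap_domain F \<and> (\<forall>i. ratfun_defined (\<sigma> (ratfun_var i)) x) \<and>
        (\<forall>j. \<not> has_value (?T (Q j)) x 0) \<and> \<not> has_value (peval ratfun_const (($) F) q) x 0) generic"
      by (intro eventually_conj eventually_all_finite eventually_ratmap_domain eventually_defined
          eventually_value_nonzero TQ algebraically_independent dominant q(1))
    then show ?thesis
    proof (rule eventually_mono)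
      fix x
      assume *: "x \<in> ratmap_domain F \<and> (\<forall>i. ratfun_defined (\<sigma> (ratfun_var i)) x) \<and>
        (\<forall>j. \<not> has_value (?T (Q j)) x 0) \<and> \<not> has_value (peval ratfun_const (($) F) q) x 0"
      \<comment> \<open>\<open>s\<close> is the image of \<open>x\<close> under the rational map
        attached to \<open>\<sigma>\<close>. It lies in the fibre of \<open>F\<close> through
        \<open>x\<close>, which is a single point because it lies over \<open>U\<close>.\<close>
      define s where "s = (\<chi> i. ratfun_eval (\<sigma> (ratfun_var i)) x)"
      have s: "has_value (\<sigma> (ratfun_var i)) x (s $ i)" for i
        using * by (simp add: s_def has_value_def)
      have T: "has_value (?T p) x (poly_eval p s)" for p
        unfolding poly_eval_peval by (intro has_value.rel_peval has_value_const s)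
      have "ratmap_eval F x \<in> U"
        using * has_value_peval_component[of x F q] by (intro q(2)) metis
      moreover have "poly_eval (Q j) s \<noteq> 0" for j
        using * T by metis
      moreover have "poly_eval (Q j) s * ratmap_eval F x $ j = poly_eval (P j) s" for j
        using has_value.rel_mult[OF T has_value_component] T[of "P j"] TPQ[of j] * has_value_unique
        by metis
      ultimately have "s \<in> ratmap_domain F" "ratmap_eval F s = ratmap_eval F x" "ratmap_eval F x \<in> U"
        using ratmap_fibre_pointI[of F P Q s, OF PQ(1)] by blast+
      then have "s = x"
        using U(3)[of "ratmap_eval F x"] * by metis
      then show "\<forall>i. has_value (\<sigma> (ratfun_var i)) x (x $ i)"
        using s by simp
    qed
  qed
  then have var: "\<sigma> (ratfun_var i) = ratfun_var i" for i
    by (intro ratfun_eqI) (auto elim!: eventually_mono intro: has_value_var)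
  have id: "\<sigma> (Fract p 1) = Fract p 1" for p
    by (simp add: peval var peval_ratfun_var)
  have "\<sigma> r = r" for r
  proof (cases r rule: Fract_cases)
    case (Fract p q)
    then have "r * Fract q 1 = Fract p 1"
      by (simp add: eq_fract)
    then have "\<sigma> r * Fract q 1 = r * Fract q 1"
      by (metis hom(2) id)
    moreover have "Fract q 1 \<noteq> 0"
      using Fract by (simp add: Zero_fract_def eq_fract)
    ultimately show ?thesis
      by simp
  qed
  then show ?thesis
    by (simp add: fun_eq_iff)
qed

end

lemma id_in_field_automorphisms_over: "id \<in> field_automorphisms_over L K"
  by (auto simp: field_automorphisms_over_def ring_iso_def ring_hom_def)

theorem proposition1:
  fixes F :: "'n::{finite,linorder} ratmap"
  assumes "dominant F"
    and "has_geometric_degree F 1"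
  shows "(\<exists>d. has_extension_degree ratfun_field (component_field F) d \<and> odd d)
    \<and> field_automorphisms_over ratfun_field (component_field F) = {id}"
proof -
  interpret dominant_ratmap F
    by unfold_locales fact
  obtain u M G where *: "minimal_poly (theta u) M" "ev (theta u) (pderiv M) \<noteq> 0"
    "\<And>k. ev (theta u) (G k) = ratfun_var k"
    using primitive_element by blast
  have "has_extension_degree ratfun_field (component_field F) (degree M)"
    using extension_degree[OF *(1)] ev_surj[OF *(1,3)] by blast
  moreover have "odd (degree M)"
    using odd_degree_minimal_poly[OF * assms(2)] .
  moreover have "field_automorphisms_over ratfun_field (component_field F) = {id}"
    using automorphism_trivial[OF _ assms(2)] id_in_field_automorphisms_over by blast
  ultimately show ?thesis
    by blast
qed

end
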